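(* There is an explicit sequence $(G_t,v_t)$, $t=1,2,\ldots$, where the $G_t$ are pairwise nonisomorphic graphs and $v_t\in V(G_t)$, such that, for every integer $t\geq 1$, the graph $G_t$ is minimally nonperfectly divisible, $\omega(G_t)=3$, and $v_t$ is a bisimplicial vertex of $G_t$ of degree four. Moreover, for every $t\ge 1$, \[ |V(G_t)|=93+30(t-1),\qquad |E(G_t)|=320+104(t-1). \]
   Context: All graphs are finite and simple. $\chi(G)$ and $\omega(G)$ denote the chromatic number and clique number of $G$, with the convention $\omega(\varnothing)=0$ for the graph with no vertices. A graph $G$ is perfect if $\chi(H)=\omega(H)$ for every induced subgraph $H$ of $G$. A perfect division of a graph $H$ is an ordered partition $V(H)=A\,\dot\cup\,B$ (disjoint union; parts may be empty) such that $H[A]$ is perfect and $\omega(H[B])<\omega(H)$, where $H[X]$ denotes the subgraph of $H$ induced by $X$; $A$ is called the perfect part. A graph $G$ is perfectly divisible if every induced subgraph of $G$ with at least one edge has a perfect division. A graph is minimally nonperfectly divisible (MNPD) if it is not perfectly divisible but each of its proper induced subgraphs is perfectly divisible. A vertex $v$ is bisimplicial if its neighbourhood is the union of two cliques. *)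

theory Defs
  imports "HOL-Library.Ramsey"
begin

text \<open>
  Edges are two-element sets of vertices, the representation for which
  HOL-Library.Ramsey defines \<open>clique\<close>.
\<close>

record 'a ugraph =
  verts :: "'a set"
  edges :: "'a set set"

definition simple_graph :: "'a ugraph \<Rightarrow> bool" where
  "simple_graph G \<longleftrightarrow> finite (verts G) \<and> edges G \<subseteq> {e. e \<subseteq> verts G \<and> card e = 2}"

definition induced :: "'a ugraph \<Rightarrow> 'a set \<Rightarrow> 'a ugraph" where
  "induced G X = \<lparr>verts = X, edges = {e \<in> edges G. e \<subseteq> X}\<rparr>"

definition graph_iso :: "'a ugraph \<Rightarrow> 'b ugraph \<Rightarrow> bool" where
  "graph_iso G H \<longleftrightarrow> (\<exists>f. bij_betw f (verts G) (verts H) \<and>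
     (\<forall>u\<in>verts G. \<forall>w\<in>verts G. {u, w} \<in> edges G \<longleftrightarrow> {f u, f w} \<in> edges H))"

definition nbhd :: "'a ugraph \<Rightarrow> 'a \<Rightarrow> 'a set" where
  "nbhd G v = {w \<in> verts G. {v, w} \<in> edges G}"

definition degree :: "'a ugraph \<Rightarrow> 'a \<Rightarrow> nat" where
  "degree G v = card (nbhd G v)"

text \<open>
  The empty set counts as a clique, so the clique number of the graph with no
  vertices is 0.
\<close>

definition clique_number :: "'a ugraph \<Rightarrow> nat" where
  "clique_number G = Max {card K |K. K \<subseteq> verts G \<and> clique K (edges G)}"

definition proper_colouring :: "'a ugraph \<Rightarrow> nat \<Rightarrow> ('a \<Rightarrow> nat) \<Rightarrow> bool" where
  "proper_colouring G k c \<longleftrightarrow> (\<forall>v\<in>verts G. c v < k) \<and>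
     (\<forall>u\<in>verts G. \<forall>w\<in>verts G. {u, w} \<in> edges G \<longrightarrow> c u \<noteq> c w)"

definition chromatic_number :: "'a ugraph \<Rightarrow> nat" where
  "chromatic_number G = (LEAST k. \<exists>c. proper_colouring G k c)"

definition perfect :: "'a ugraph \<Rightarrow> bool" where
  "perfect G \<longleftrightarrow>
     (\<forall>X \<subseteq> verts G. chromatic_number (induced G X) = clique_number (induced G X))"

definition perfect_division :: "'a ugraph \<Rightarrow> 'a set \<Rightarrow> 'a set \<Rightarrow> bool" where
  "perfect_division H A B \<longleftrightarrow> A \<union> B = verts H \<and> A \<inter> B = {} \<and>
     perfect (induced H A) \<and> clique_number (induced H B) < clique_number H"

definition perfectly_divisible :: "'a ugraph \<Rightarrow> bool" where
  "perfectly_divisible G \<longleftrightarrow>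
     (\<forall>X \<subseteq> verts G. edges (induced G X) \<noteq> {} \<longrightarrow> (\<exists>A B. perfect_division (induced G X) A B))"

definition mnpd :: "'a ugraph \<Rightarrow> bool" where
  "mnpd G \<longleftrightarrow> \<not> perfectly_divisible G \<and> (\<forall>X \<subset> verts G. perfectly_divisible (induced G X))"

definition bisimplicial :: "'a ugraph \<Rightarrow> 'a \<Rightarrow> bool" where
  "bisimplicial G v \<longleftrightarrow> (\<exists>K L. nbhd G v = K \<union> L \<and> clique K (edges G) \<and> clique L (edges G))"

end

theory Submission
  imports Defs
begin

text \<open>
  A partition \<open>(A, B)\<close> of a graph with clique number 3 is a perfect division iff \<open>A\<close> induces a perfect
  graph and \<open>B\<close> is triangle-free. So a division puts no triangle into \<open>B\<close> and no odd hole into \<open>A\<close>,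
  and both restrictions can be used to force vertices to one side.

  The building block is a \<open>gadget\<close> on 15 vertices with a distinguished vertex, its root, numbered 0. If the
  root is in \<open>B\<close>, then some triangle of the gadget lies in \<open>B\<close> or some induced 5-cycle lies in \<open>A\<close>; so in a
  division the root is in \<open>A\<close> (\<open>gadget_forces_root\<close>). Every other vertex is needed for this: the gadget without
  it has a partition with the root in \<open>B\<close>. The intact gadget has a partition in which the root is in \<open>A\<close>
  and all its neighbours are in \<open>B\<close> (\<open>gadget_partition\<close>).

  For even \<open>n \<ge> 6\<close>, the graph \<open>chain n\<close> consists of \<open>n\<close> disjoint gadgets, numbered from 0, whose roots
  are joined to a path in this order, and of three more vertices, the apexes \<open>v\<close>, \<open>b\<close>, \<open>c\<close>. These form a triangle;
  \<open>v\<close> is joined to both ends of the path, \<open>b\<close> to the roots 0 and 3, and \<open>c\<close> to the roots \<open>n - 4\<close> and \<open>n - 1\<close>.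
  The four neighbours of \<open>v\<close> are \<open>b\<close> with the first root and \<open>c\<close> with the last root, two adjacent pairs;
  so \<open>v\<close> is bisimplicial.

  There is no division (\<open>chain_indivisible\<close>). All roots are in \<open>A\<close>. Each apex closes an odd hole with a
  segment of the path: \<open>b\<close> and \<open>c\<close> a 5-cycle, and \<open>v\<close> a cycle of length \<open>n + 1\<close>. So all three are in \<open>B\<close>,
  where they form a triangle. Every vertex is needed for this argument (\<open>chain_critical\<close>). Without an apex the
  triangle is gone. Without a vertex of a gadget, the root of that gadget can be moved to \<open>B\<close> or is itself
  missing; then the path is broken and \<open>v\<close> can be moved to \<open>A\<close>. In these partitions no root in \<open>A\<close> has a
  neighbour in \<open>A\<close> inside its own gadget, so the graph on \<open>A\<close> is a disjoint union of pieces of gadgets and of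
  paths of roots and \<open>v\<close>, and it is chordal.

  A proper induced subgraph with a triangle inherits the division of \<open>chain n\<close> without a vertex outside it.
  A triangle-free one is divided by a 3-colouring, two colour classes against the third. The 3-colourings
  come from those of the triangle-free subsets of the gadget and of the subgraph on the roots and apexes, glued
  at the roots after permuting colours (\<open>chain_three_colourable\<close>).

  Since \<open>chain n\<close> has \<open>15 n + 3\<close> vertices and \<open>51 n + (n - 1) + 9\<close> edges, \<open>n = 2 t + 4\<close> gives the stated numbers.
\<close>

section \<open>Triangles, colourings and clique numbers\<close>

abbreviation adjacent :: "'a ugraph \<Rightarrow> 'a \<Rightarrow> 'a \<Rightarrow> bool" where
  "adjacent G x y \<equiv> {x, y} \<in> edges G"

definition triangle_free :: "'a ugraph \<Rightarrow> 'a set \<Rightarrow> bool" where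
  "triangle_free G X \<longleftrightarrow>
     (\<forall>x\<in>X. \<forall>y\<in>X. \<forall>z\<in>X. \<not> (adjacent G x y \<and> adjacent G y z \<and> adjacent G x z))"

definition colouring_on :: "'a ugraph \<Rightarrow> 'a set \<Rightarrow> nat \<Rightarrow> ('a \<Rightarrow> nat) \<Rightarrow> bool" where
  "colouring_on G X k c \<longleftrightarrow> (\<forall>x\<in>X. c x < k) \<and> (\<forall>x\<in>X. \<forall>y\<in>X. adjacent G x y \<longrightarrow> c x \<noteq> c y)"

lemma triangle_freeI:
  assumes "\<And>x y z. \<lbrakk>x \<in> X; y \<in> X; z \<in> X; adjacent G x y; adjacent G y z; adjacent G x z\<rbrakk> \<Longrightarrow> False"
  shows "triangle_free G X"
  using assms unfolding triangle_free_def by blast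

lemma triangle_freeD:
  "\<lbrakk>triangle_free G X; x \<in> X; y \<in> X; z \<in> X; adjacent G x y; adjacent G y z; adjacent G x z\<rbrakk> \<Longrightarrow> False"
  unfolding triangle_free_def by blast

lemma triangle_free_subset: "triangle_free G X \<Longrightarrow> Y \<subseteq> X \<Longrightarrow> triangle_free G Y"
  unfolding triangle_free_def by blast

lemma colouring_on_subset: "colouring_on G X k c \<Longrightarrow> Y \<subseteq> X \<Longrightarrow> colouring_on G Y k c"
  unfolding colouring_on_def by blast

lemma colouring_on_mono: "colouring_on G X k c \<Longrightarrow> k \<le> l \<Longrightarrow> colouring_on G X l c"
  unfolding colouring_on_def by force

lemma verts_induced [simp]: "verts (induced G X) = X"
  by (simp add: induced_def)

lemma induced_induced: "Y \<subseteq> X \<Longrightarrow> induced (induced G X) Y = induced G Y"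
  unfolding induced_def by auto

lemma proper_colouring_induced: "proper_colouring (induced G X) k c \<longleftrightarrow> colouring_on G X k c"
  unfolding proper_colouring_def colouring_on_def induced_def by auto

lemma clique_induced: "K \<subseteq> X \<Longrightarrow> clique K (edges (induced G X)) \<longleftrightarrow> clique K (edges G)"
  unfolding clique_def induced_def by auto

lemma adjacent_neq: "simple_graph G \<Longrightarrow> adjacent G x y \<Longrightarrow> x \<noteq> y"
  unfolding simple_graph_def by (auto dest: subsetD)

lemma adjacent_sym: "adjacent G x y \<Longrightarrow> adjacent G y x"
  by (simp add: insert_commute)

lemma clique_numbers_finite:
  assumes "finite X"
  shows "finite {card K |K. K \<subseteq> X \<and> clique K E}"
proof -
  have "{card K |K. K \<subseteq> X \<and> clique K E} = card ` {K. K \<subseteq> X \<and> clique K E}" by auto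
  then show ?thesis using assms by simp
qed

lemma clique_number_induced:
  "clique_number (induced G X) = Max {card K |K. K \<subseteq> X \<and> clique K (edges G)}"
proof -
  have "{card K |K. K \<subseteq> verts (induced G X) \<and> clique K (edges (induced G X))}
      = {card K |K. K \<subseteq> X \<and> clique K (edges G)}"
    using clique_induced by (metis verts_induced)
  then show ?thesis unfolding clique_number_def by simp
qed

lemma card_clique_le:
  assumes "finite X" "K \<subseteq> X" "clique K (edges G)"
  shows "card K \<le> clique_number (induced G X)"
  unfolding clique_number_induced
  by (rule Max_ge[OF clique_numbers_finite[OF assms(1)]]) (use assms in blast)

lemma maximum_clique:
  assumes "finite X"
  obtains K where "K \<subseteq> X" "clique K (edges G)" "card K = clique_number (induced G X)"
proof -
  have "Max {card K |K. K \<subseteq> X \<and> clique K (edges G)} \<in> {card K |K. K \<subseteq> X \<and> clique K (edges G)}"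
    by (rule Max_in[OF clique_numbers_finite[OF assms]]) (use null_clique in blast)
  then show thesis using that unfolding clique_number_induced by auto
qed

lemma clique_number_mono:
  assumes "finite X" "Y \<subseteq> X"
  shows "clique_number (induced G Y) \<le> clique_number (induced G X)"
proof -
  obtain K where "K \<subseteq> Y" "clique K (edges G)" "card K = clique_number (induced G Y)"
    using maximum_clique[OF finite_subset[OF assms(2,1)]] by metis
  then show ?thesis using card_clique_le[OF assms(1), of K G] assms(2) by auto
qed

text \<open>
  A colouring is injective on every clique.
\<close>

lemma clique_number_le_colours:
  assumes "finite X" "colouring_on G X k c"
  shows "clique_number (induced G X) \<le> k"
proof -
  obtain K where K: "K \<subseteq> X" "clique K (edges G)" "card K = clique_number (induced G X)"
    using maximum_clique[OF assms(1)] by metis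
  have "inj_on c K"
    using K assms(2) unfolding inj_on_def clique_def colouring_on_def by blast
  moreover have "c ` K \<subseteq> {..<k}"
    using K(1) assms(2) unfolding colouring_on_def by auto
  ultimately have "card K \<le> card {..<k}"
    by (rule card_inj_on_le) simp
  then show ?thesis using K(3) by simp
qed

lemma clique_number_edgeless:
  assumes "finite X" "\<And>x y. x \<in> X \<Longrightarrow> y \<in> X \<Longrightarrow> \<not> adjacent G x y"
  shows "clique_number (induced G X) \<le> 1"
  by (rule clique_number_le_colours[OF assms(1), of _ _ "\<lambda>_. 0"])
     (use assms(2) in \<open>auto simp: colouring_on_def\<close>)

lemma clique_number_edge:
  assumes "simple_graph G" "finite X" "x \<in> X" "y \<in> X" "adjacent G x y"
  shows "2 \<le> clique_number (induced G X)"
proof -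
  have "clique {x, y} (edges G)"
    using assms(5) by (auto simp: clique_def insert_commute)
  then have "card {x, y} \<le> clique_number (induced G X)"
    using assms by (intro card_clique_le) auto
  then show ?thesis using adjacent_neq[OF assms(1,5)] by simp
qed

lemma clique_number_triangle:
  assumes "simple_graph G" "finite X" "x \<in> X" "y \<in> X" "z \<in> X"
    and "adjacent G x y" "adjacent G y z" "adjacent G x z"
  shows "3 \<le> clique_number (induced G X)"
proof -
  have "clique {x, y, z} (edges G)"
    using assms by (auto simp: clique_def insert_commute)
  then have "card {x, y, z} \<le> clique_number (induced G X)"
    using assms by (intro card_clique_le) auto
  moreover have "x \<noteq> y" "y \<noteq> z" "x \<noteq> z"
    using adjacent_neq[OF assms(1)] assms(6-8) by metis+
  ultimately show ?thesis by simp
qed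

lemma clique_number_triangle_free:
  assumes "finite X" "triangle_free G X"
  shows "clique_number (induced G X) \<le> 2"
proof (rule ccontr)
  assume "\<not> ?thesis"
  moreover obtain K where K: "K \<subseteq> X" "clique K (edges G)" "card K = clique_number (induced G X)"
    using maximum_clique[OF assms(1)] by metis
  ultimately have "3 \<le> card K" by simp
  then obtain T where "T \<subseteq> K" "card T = 3"
    by (metis obtain_subset_with_card_n)
  then obtain x y z where "x \<in> K" "y \<in> K" "z \<in> K" "x \<noteq> y" "y \<noteq> z" "x \<noteq> z"
    by (auto simp: card_3_iff)
  then show False
    using K(1,2) assms(2) unfolding clique_def triangle_free_def by blast
qed

section \<open>Perfect induced subgraphs\<close>

text \<open>
  Since the chromatic number is never smaller than the clique number, equality only asks for a colouring with
  as many colours as the clique number. This removes the minimum from the definition of perfection.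
\<close>

lemma chromatic_eq_clique_number_iff:
  assumes "simple_graph G" "finite X"
  shows "chromatic_number (induced G X) = clique_number (induced G X)
    \<longleftrightarrow> (\<exists>c. colouring_on G X (clique_number (induced G X)) c)"
    (is "?l \<longleftrightarrow> ?r")
proof
  assume l: ?l
  obtain f :: "'a \<Rightarrow> nat" and m where f: "f ` X = {i. i < m}" "inj_on f X"
    using finite_imp_inj_to_nat_seg[OF assms(2)] by metis
  have "colouring_on G X m f"
    using f adjacent_neq[OF assms(1)] unfolding colouring_on_def inj_on_def by blast
  then have "\<exists>k c. colouring_on G X k c" by blast
  then have "\<exists>c. colouring_on G X (LEAST k. \<exists>c. colouring_on G X k c) c"
    by (rule LeastI_ex)
  then show ?r
    using l unfolding chromatic_number_def proper_colouring_induced by simp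
next
  assume ?r
  then show ?l
    unfolding chromatic_number_def proper_colouring_induced
    by (intro Least_equality) (use clique_number_le_colours[OF assms(2)] in blast)+
qed

lemma perfect_iff:
  assumes "simple_graph G" "finite A"
  shows "perfect (induced G A) \<longleftrightarrow> (\<forall>X\<subseteq>A. \<exists>c. colouring_on G X (clique_number (induced G X)) c)"
  using chromatic_eq_clique_number_iff[OF assms(1) finite_subset[OF _ assms(2)]]
  unfolding perfect_def by (simp add: induced_induced cong: imp_cong)

lemma perfect_subset:
  assumes "perfect (induced G A)" "A' \<subseteq> A"
  shows "perfect (induced G A')"
  unfolding perfect_def
proof (intro allI impI)
  fix X assume "X \<subseteq> verts (induced G A')"
  then have X: "X \<subseteq> A'" by simp
  have "X \<subseteq> verts (induced G A)" using X assms(2) by simp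
  then have "chromatic_number (induced (induced G A) X) = clique_number (induced (induced G A) X)"
    using assms(1) unfolding perfect_def by blast
  then show "chromatic_number (induced (induced G A') X) = clique_number (induced (induced G A') X)"
    using induced_induced[OF X, of G] induced_induced[OF order.trans[OF X assms(2)], of G] by simp
qed

text \<open>
  If the neighbours of \<open>v\<close> in \<open>A\<close> form a clique, then within any \<open>X\<close> containing \<open>v\<close> they and \<open>v\<close> form a clique of \<open>X\<close>. They
  therefore use fewer colours than the clique number of \<open>X\<close>, and a colour remains for \<open>v\<close>.
\<close>

lemma perfect_insert_simplicial:
  assumes G: "simple_graph G" and A: "finite A"
    and perf: "perfect (induced G A)" and simplicial: "clique {w \<in> A. adjacent G v w} (edges G)"
  shows "perfect (induced G (insert v A))"
proof (cases "v \<in> A")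
  case False
  show ?thesis
    unfolding perfect_iff[OF G finite.insertI[OF A]]
  proof (intro allI impI)
    fix X assume X: "X \<subseteq> insert v A"
    have finX: "finite X" using X A finite_subset by blast
    show "\<exists>c. colouring_on G X (clique_number (induced G X)) c"
    proof (cases "v \<in> X")
      case False
      then show ?thesis using X perf perfect_iff[OF G A] by (metis subset_insert)
    next
      case True
      define Y where "Y = X - {v}"
      define N where "N = {w \<in> Y. adjacent G v w}"
      have Y: "Y \<subseteq> A" "v \<notin> Y" "X = insert v Y" "Y \<subseteq> X" using X True by (auto simp: Y_def)
      have finY: "finite Y" using finite_subset[OF Y(1) A] .
      obtain c where "colouring_on G Y (clique_number (induced G Y)) c"
        using perf perfect_iff[OF G A] Y(1) by metis
      then have c: "colouring_on G Y (clique_number (induced G X)) c"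
        using clique_number_mono[OF finX Y(4), of G] by (rule colouring_on_mono)
      have finN: "finite N" using finY by (simp add: N_def)
      have "clique N (edges G)" by (rule smaller_clique[OF simplicial]) (use Y(1) in \<open>auto simp: N_def\<close>)
      then have "clique (insert v N) (edges G)"
        by (auto simp: clique_def N_def insert_commute)
      then have "card (insert v N) \<le> clique_number (induced G X)"
        by (rule card_clique_le[OF finX, rotated]) (use Y in \<open>auto simp: N_def\<close>)
      then have "card N < clique_number (induced G X)"
        using finN Y(2) by (simp add: N_def)
      then have "card (c ` N) < card {..<clique_number (induced G X)}"
        using card_image_le[OF finN, of c] by simp
      then have "\<not> {..<clique_number (induced G X)} \<subseteq> c ` N"
        using card_mono[OF finite_imageI[OF finN]] by (meson not_le)
      then obtain k where k: "k < clique_number (induced G X)" "k \<notin> c ` N" by auto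
      have "c w \<noteq> k" if "w \<in> Y" "adjacent G v w" for w
        using k(2) that by (auto simp: N_def)
      moreover have "c w \<noteq> k" if "w \<in> Y" "adjacent G w v" for w
        using calculation that adjacent_sym by metis
      ultimately have "colouring_on G X (clique_number (induced G X)) (c(v := k))"
        using c k(1) Y(2) adjacent_neq[OF G, of v v] unfolding colouring_on_def Y(3) by force
      then show ?thesis by blast
    qed
  qed
qed (use perf in \<open>simp add: insert_absorb\<close>)

text \<open>
  A perfect elimination order of the subgraph induced by \<open>A\<close>, given as a rank function so that orders of
  different pieces of a graph can be combined without interleaving lists. Equal ranks are allowed: adjacent
  vertices of equal rank see each other.
\<close>

definition ranked :: "'a ugraph \<Rightarrow> 'a set \<Rightarrow> ('a \<Rightarrow> nat) \<Rightarrow> bool" where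
  "ranked G A r \<longleftrightarrow> (\<forall>v\<in>A. clique {w \<in> A. adjacent G v w \<and> r w \<le> r v} (edges G))"

text \<open>
  Chordal graphs are perfect: the vertices are added by increasing rank, and each is simplicial when it is added.
\<close>

lemma perfect_if_ranked:
  fixes r :: "'a \<Rightarrow> nat"
  assumes "simple_graph G" "finite A"
    and "ranked G A r"
  shows "perfect (induced G A)"
  using assms(2,3) unfolding ranked_def
proof (induction A rule: finite_ranking_induct[where f = r])
  case empty
  show ?case
    unfolding perfect_iff[OF assms(1) finite.emptyI] by (auto simp: colouring_on_def)
next
  case (insert v A)
  have "perfect (induced G A)"
  proof (rule insert.IH, intro ballI)
    fix w assume "w \<in> A"
    then show "clique {u \<in> A. adjacent G w u \<and> r u \<le> r w} (edges G)"
      by (intro smaller_clique[OF bspec[OF insert.prems, of w]]) auto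
  qed
  moreover have "clique {w \<in> A. adjacent G v w} (edges G)"
    by (rule smaller_clique[OF bspec[OF insert.prems, of v]]) (use insert.hyps in auto)
  ultimately show ?case
    using perfect_insert_simplicial[OF assms(1) insert.hyps(1)] by blast
qed

lemma perfect_bipartite:
  assumes G: "simple_graph G" and A: "finite A" and c: "colouring_on G A 2 c"
  shows "perfect (induced G A)"
  unfolding perfect_iff[OF G A]
proof (intro allI impI)
  fix X assume X: "X \<subseteq> A"
  have finX: "finite X" using finite_subset[OF X A] .
  show "\<exists>c. colouring_on G X (clique_number (induced G X)) c"
  proof (cases "\<exists>x\<in>X. \<exists>y\<in>X. adjacent G x y")
    case True
    then have "2 \<le> clique_number (induced G X)"
      using clique_number_edge[OF G finX] by blast
    then show ?thesis
      using colouring_on_mono colouring_on_subset[OF c X] by blast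
  next
    case False
    show ?thesis
    proof (cases "X = {}")
      case True
      then show ?thesis by (simp add: colouring_on_def)
    next
      case nonempty: False
      then obtain x where "x \<in> X" by blast
      then have "1 \<le> clique_number (induced G X)"
        using card_clique_le[OF finX, of "{x}" G] by (simp add: clique_def)
      then have "colouring_on G X (clique_number (induced G X)) (\<lambda>_. 0)"
        using False by (auto simp: colouring_on_def)
      then show ?thesis by blast
    qed
  qed
qed

text \<open>
  A triangle-free set inside a perfect graph has a 2-colouring, and colours alternate along the
  cycle. Being triangle-free is all that is asked of the cycle; it may have chords, which saves checking that
  it has none.
\<close>

lemma no_odd_hole_in_perfect:
  assumes G: "simple_graph G" and A: "finite A" and perf: "perfect (induced G A)"
    and sub: "x ` {..<L} \<subseteq> A" and tf: "triangle_free G (x ` {..<L})" and "odd L"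
    and step: "\<And>i. Suc i < L \<Longrightarrow> adjacent G (x i) (x (Suc i))"
    and close: "adjacent G (x (L - 1)) (x 0)"
  shows False
proof -
  have "0 < L" using \<open>odd L\<close> by (auto intro: Nat.gr0I)
  obtain c where "colouring_on G (x ` {..<L}) (clique_number (induced G (x ` {..<L}))) c"
    using perf sub unfolding perfect_iff[OF G A] by metis
  then have c: "colouring_on G (x ` {..<L}) 2 c"
    using clique_number_triangle_free[OF _ tf] colouring_on_mono by blast
  have two: "c (x i) < 2" if "i < L" for i using c that by (auto simp: colouring_on_def)
  have "c (x i) = (c (x 0) + i) mod 2" if "i < L" for i
    using that
  proof (induction i)
    case 0
    then show ?case using two by simp
  next
    case (Suc i)
    have "c (x i) \<noteq> c (x (Suc i))"
      using c step[OF Suc.prems] Suc.prems by (simp add: colouring_on_def)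
    then have "c (x (Suc i)) = (c (x i) + 1) mod 2"
      using two[of i] two[OF Suc.prems] Suc.prems by (auto simp: less_2_cases_iff)
    then show ?case using Suc by (simp add: mod_simps)
  qed
  from this[of "L - 1"] have "c (x (L - 1)) = c (x 0)"
    using \<open>odd L\<close> \<open>0 < L\<close> two[of 0] by (auto elim!: oddE)
  moreover have "c (x (L - 1)) \<noteq> c (x 0)"
    using c close \<open>0 < L\<close> by (simp add: colouring_on_def)
  ultimately show False by simp
qed

section \<open>Triangle-free sets with three colours\<close>

definition hereditarily_3_colourable :: "'a ugraph \<Rightarrow> 'a set \<Rightarrow> bool" where
  "hereditarily_3_colourable G Y \<longleftrightarrow>
    (\<forall>X\<subseteq>Y. triangle_free G X \<longrightarrow> (\<exists>c. colouring_on G X 3 c))"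

text \<open>
  A triangle-free set misses a vertex of every triangle.
\<close>

lemma hereditarily_3_colourable_branch:
  assumes "adjacent G x y" "adjacent G y z" "adjacent G x z"
    and "hereditarily_3_colourable G (Y - {x})" "hereditarily_3_colourable G (Y - {y})"
      "hereditarily_3_colourable G (Y - {z})"
  shows "hereditarily_3_colourable G Y"
  unfolding hereditarily_3_colourable_def
proof (intro allI impI)
  fix X assume X: "X \<subseteq> Y" "triangle_free G X"
  then have "x \<notin> X \<or> y \<notin> X \<or> z \<notin> X"
    using assms(1-3) unfolding triangle_free_def by blast
  then have "X \<subseteq> Y - {x} \<or> X \<subseteq> Y - {y} \<or> X \<subseteq> Y - {z}" using X(1) by blast
  then show "\<exists>c. colouring_on G X 3 c"
    using assms(4-6) X(2) unfolding hereditarily_3_colourable_def by blast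
qed

text \<open>
  In a triangle-free set the neighbours of \<open>v\<close> are pairwise nonadjacent. If \<open>v\<close> has no three pairwise nonadjacent
  neighbours in \<open>Y\<close>, at most two of them occur, and one of three colours is left for \<open>v\<close>.
\<close>

lemma hereditarily_3_colourable_remove:
  assumes G: "simple_graph G"
    and no_independent_triple: "\<And>x y z. \<lbrakk>x \<in> Y; y \<in> Y; z \<in> Y; adjacent G v x; adjacent G v y; adjacent G v z;
      x \<noteq> y; x \<noteq> z; y \<noteq> z\<rbrakk> \<Longrightarrow> adjacent G x y \<or> adjacent G x z \<or> adjacent G y z"
    and Y: "hereditarily_3_colourable G (Y - {v})"
  shows "hereditarily_3_colourable G Y"
  unfolding hereditarily_3_colourable_def
proof (intro allI impI)
  fix X assume X: "X \<subseteq> Y" "triangle_free G X"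
  have "X - {v} \<subseteq> Y - {v}" "triangle_free G (X - {v})"
    using X triangle_free_subset by blast+
  then obtain c where c: "colouring_on G (X - {v}) 3 c"
    using Y unfolding hereditarily_3_colourable_def by blast
  show "\<exists>c. colouring_on G X 3 c"
  proof (cases "v \<in> X")
    case False
    then show ?thesis using c by auto
  next
    case True
    define N where "N = {w \<in> X. adjacent G v w}"
    have "\<not> adjacent G x y" if "x \<in> N" "y \<in> N" for x y
      using that True X(2) by (auto simp: N_def dest: triangle_freeD)
    then have N: "x = y \<or> x = z \<or> y = z" if "x \<in> N" "y \<in> N" "z \<in> N" for x y z
      using that no_independent_triple[of x y z] X(1) by (auto simp: N_def)
    have "\<exists>k<3. k \<notin> c ` N"
    proof (rule ccontr)
      assume "\<not> ?thesis"
      then have "0 \<in> c ` N" "1 \<in> c ` N" "2 \<in> c ` N" by auto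
      then obtain x y z where xyz: "x \<in> N" "y \<in> N" "z \<in> N" "c x = 0" "c y = 1" "c z = 2" by force
      then show False using N[OF xyz(1-3)] by auto
    qed
    then obtain k where k: "k < 3" "k \<notin> c ` N" by blast
    have out: "c w \<noteq> k" if "w \<in> X" "adjacent G v w" for w
      using k(2) that by (auto simp: N_def)
    have "c w \<noteq> k" if "w \<in> X" "adjacent G w v" for w
      using out that adjacent_sym by metis
    then have "colouring_on G X 3 (c(v := k))"
      using c k(1) out adjacent_neq[OF G, of v v] unfolding colouring_on_def by auto
    then show ?thesis by blast
  qed
qed

section \<open>A criterion for minimal nonperfect divisibility\<close>

text \<open>
  Two colour classes induce a bipartite, hence perfect, graph; the third is edgeless, while the graph has an edge.
\<close>

lemma perfect_division_triangle_free:
  assumes G: "simple_graph G" and X: "X \<subseteq> verts G" and tf: "triangle_free G X"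
    and edge: "edges (induced G X) \<noteq> {}" and c: "colouring_on G X 3 c"
  shows "\<exists>A B. perfect_division (induced G X) A B"
proof -
  have finX: "finite X" using G X finite_subset unfolding simple_graph_def by blast
  define A where "A = {x \<in> X. c x < 2}"
  define B where "B = {x \<in> X. c x = 2}"
  have split: "A \<union> B = X" "A \<inter> B = {}"
    using c by (force simp: A_def B_def colouring_on_def)+
  have "colouring_on G A 2 c"
    using c by (auto simp: A_def colouring_on_def)
  then have A: "perfect (induced G A)"
    using finX by (intro perfect_bipartite[OF G]) (auto simp: A_def)
  have "clique_number (induced G B) \<le> 1"
    by (rule clique_number_edgeless) (use finX c in \<open>auto simp: B_def colouring_on_def\<close>)
  moreover obtain x y where "x \<in> X" "y \<in> X" "adjacent G x y"
  proof -
    obtain e where e: "e \<in> edges G" "e \<subseteq> X" using edge by (auto simp: induced_def)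
    then have "card e = 2" using G by (auto simp: simple_graph_def)
    then show thesis using that e by (auto simp: card_2_iff)
  qed
  then have "2 \<le> clique_number (induced G X)"
    by (rule clique_number_edge[OF G finX])
  ultimately show ?thesis
    using A split unfolding perfect_division_def by (rule_tac x = A in exI, rule_tac x = B in exI) (auto simp: induced_induced)
qed

text \<open>
  The perfect divisions of a proper induced subgraph have two sources. If it contains a triangle, its clique number
  is 3 and it inherits the partition of the graph without one vertex outside it. Otherwise it has a 3-colouring.
\<close>

lemma mnpdI:
  assumes G: "simple_graph G"
    and omega: "clique_number G = 3"
    and indivisible: "\<And>A B. \<lbrakk>A \<union> B = verts G; A \<inter> B = {}; perfect (induced G A); triangle_free G B\<rbrakk> \<Longrightarrow> False"
    and critical: "\<And>u. u \<in> verts G \<Longrightarrow> \<exists>A B. A \<union> B = verts G - {u} \<and> A \<inter> B = {} \<and>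
      perfect (induced G A) \<and> triangle_free G B"
    and three: "\<And>X. X \<subseteq> verts G \<Longrightarrow> triangle_free G X \<Longrightarrow> \<exists>c. colouring_on G X 3 c"
  shows "mnpd G"
proof -
  have fin: "finite (verts G)" using G by (simp add: simple_graph_def)
  have whole: "induced G (verts G) = G"
    using G by (cases G) (auto simp: induced_def simple_graph_def)
  have "\<not> perfectly_divisible G"
  proof
    assume "perfectly_divisible G"
    moreover have "edges (induced G (verts G)) \<noteq> {}"
    proof
      assume "edges (induced G (verts G)) = {}"
      then have "clique_number (induced G (verts G)) \<le> 1"
        by (intro clique_number_edgeless[OF fin]) (simp add: whole)
      then show False using omega whole by simp
    qed
    ultimately obtain A B where "perfect_division G A B"
      unfolding perfectly_divisible_def using whole by (metis order.refl)
    then have AB: "A \<union> B = verts G" "A \<inter> B = {}" "perfect (induced G A)" "clique_number (induced G B) < 3"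
      unfolding perfect_division_def omega by auto
    have "finite B" using fin AB(1) by (metis finite_Un)
    then have "triangle_free G B"
      using clique_number_triangle[OF G, of B] AB(4) unfolding triangle_free_def by (meson not_le)
    then show False using indivisible AB by blast
  qed
  moreover have "perfectly_divisible (induced G X)" if X: "X \<subset> verts G" for X
    unfolding perfectly_divisible_def
  proof (intro allI impI)
    fix Y assume "Y \<subseteq> verts (induced G X)" and edge: "edges (induced (induced G X) Y) \<noteq> {}"
    then have YX: "Y \<subseteq> X" by simp
    then have Y: "Y \<subseteq> verts G" "induced (induced G X) Y = induced G Y" using X induced_induced by blast+
    have finY: "finite Y" using finite_subset[OF Y(1) fin] .
    have "\<exists>A B. perfect_division (induced G Y) A B"
    proof (cases "triangle_free G Y")
      case True
      then show ?thesis
        using three[OF Y(1) True] perfect_division_triangle_free[OF G Y(1) True] edge Y(2) by auto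
    next
      case False
      then have three: "3 \<le> clique_number (induced G Y)"
        using clique_number_triangle[OF G finY] unfolding triangle_free_def by blast
      obtain u where u: "u \<in> verts G" "u \<notin> Y" using X YX by blast
      obtain A B where AB: "A \<union> B = verts G - {u}" "A \<inter> B = {}"
          "perfect (induced G A)" "triangle_free G B"
        using critical[OF u(1)] by blast
      have "clique_number (induced G (B \<inter> Y)) \<le> 2"
        using triangle_free_subset[OF AB(4)] finY by (intro clique_number_triangle_free) auto
      then have "clique_number (induced G (B \<inter> Y)) < clique_number (induced G Y)"
        using three by simp
      moreover have "perfect (induced G (A \<inter> Y))"
        by (rule perfect_subset[OF AB(3)]) simp
      moreover have "A \<inter> Y \<union> B \<inter> Y = Y" using AB(1) u(2) Y(1) by blast
      ultimately show ?thesis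
        unfolding perfect_division_def using AB(2)
        by (rule_tac x = "A \<inter> Y" in exI, rule_tac x = "B \<inter> Y" in exI) (auto simp: induced_induced)
    qed
    then show "\<exists>A B. perfect_division (induced (induced G X) Y) A B" using Y(2) by simp
  qed
  ultimately show ?thesis unfolding mnpd_def by blast
qed

section \<open>The gadget\<close>

text \<open>
  The root is 0; its neighbours are 1 to 10.
\<close>

definition gadget_edges :: "(nat \<times> nat) list" where
  "gadget_edges =
    [(0, 1), (0, 2), (0, 3), (0, 4), (0, 5), (0, 6), (0, 7), (0, 8),
     (0, 9), (0, 10), (1, 3), (1, 4), (1, 5), (1, 9), (1, 11), (1, 13),
     (1, 14), (2, 3), (2, 6), (2, 8), (2, 9), (2, 11), (2, 12), (3, 10),
     (3, 12), (3, 14), (4, 7), (4, 8), (4, 11), (5, 6), (5, 8), (5, 12),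
     (5, 13), (5, 14), (6, 7), (6, 11), (6, 12), (6, 13), (7, 9), (7, 10),
     (7, 12), (7, 14), (8, 10), (8, 12), (8, 13), (9, 11), (9, 14), (10, 11),
     (10, 13), (11, 13), (12, 14)]"

definition gadget :: "nat ugraph" where
  "gadget = \<lparr>verts = {..<15}, edges = {{j, k} |j k. (j, k) \<in> set gadget_edges}\<rparr>"

text \<open>
  Adjacency in the gadget, separated from the set of edges so that it can be evaluated by rewriting.
\<close>

definition joined :: "nat \<Rightarrow> nat \<Rightarrow> bool" where
  "joined j k \<longleftrightarrow> (j, k) \<in> set gadget_edges \<or> (k, j) \<in> set gadget_edges"

lemma adjacent_gadget: "adjacent gadget j k \<longleftrightarrow> joined j k"
  by (auto simp: gadget_def joined_def doubleton_eq_iff)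

lemma joined_table:
  "joined 0 k \<longleftrightarrow> k \<in> {1, 2, 3, 4, 5, 6, 7, 8, 9, 10}"
  "joined (Suc 0) k \<longleftrightarrow> k \<in> {0, 3, 4, 5, 9, 11, 13, 14}"
  "joined 2 k \<longleftrightarrow> k \<in> {0, 3, 6, 8, 9, 11, 12}"
  "joined 3 k \<longleftrightarrow> k \<in> {0, 1, 2, 10, 12, 14}"
  "joined 4 k \<longleftrightarrow> k \<in> {0, 1, 7, 8, 11}"
  "joined 5 k \<longleftrightarrow> k \<in> {0, 1, 6, 8, 12, 13, 14}"
  "joined 6 k \<longleftrightarrow> k \<in> {0, 2, 5, 7, 11, 12, 13}"
  "joined 7 k \<longleftrightarrow> k \<in> {0, 4, 6, 9, 10, 12, 14}"
  "joined 8 k \<longleftrightarrow> k \<in> {0, 2, 4, 5, 10, 12, 13}"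
  "joined 9 k \<longleftrightarrow> k \<in> {0, 1, 2, 7, 11, 14}"
  "joined 10 k \<longleftrightarrow> k \<in> {0, 3, 7, 8, 11, 13}"
  "joined 11 k \<longleftrightarrow> k \<in> {1, 2, 4, 6, 9, 10, 13}"
  "joined 12 k \<longleftrightarrow> k \<in> {2, 3, 5, 6, 7, 8, 14}"
  "joined 13 k \<longleftrightarrow> k \<in> {1, 5, 6, 8, 10, 11}"
  "joined 14 k \<longleftrightarrow> k \<in> {1, 3, 5, 7, 9, 12}"
  by (auto simp: joined_def gadget_edges_def)

abbreviation gadget_vertices :: "nat list" where
  "gadget_vertices \<equiv> [0, 1, 2, 3, 4, 5, 6, 7, 8, 9, 10, 11, 12, 13, 14]"

lemma set_gadget_vertices: "set gadget_vertices = {..<15}"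
proof -
  have "gadget_vertices = [0..<15]" by (simp add: upt_conv_Cons)
  then show ?thesis by (metis atLeast_upt)
qed

lemma simple_gadget: "simple_graph gadget"
  by (auto simp: simple_graph_def gadget_def gadget_edges_def)

lemma joined_sym: "joined j k \<longleftrightarrow> joined k j"
  by (auto simp: joined_def)

lemma joined_less: "joined j k \<Longrightarrow> j < 15 \<and> k < 15"
  by (auto simp: joined_def gadget_edges_def)

lemma joined_irrefl: "\<not> joined j j"
  by (auto simp: joined_def gadget_edges_def)

definition triangle_free_list :: "nat list \<Rightarrow> bool" where
  "triangle_free_list xs \<longleftrightarrow>
    list_all (\<lambda>x. list_all (\<lambda>y. joined x y \<longrightarrow> list_all (\<lambda>z. joined y z \<longrightarrow> \<not> joined x z) xs) xs) xs"

lemma triangle_free_list: "triangle_free_list xs \<Longrightarrow> triangle_free gadget (set xs)"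
  unfolding triangle_free_list_def triangle_free_def list_all_iff adjacent_gadget by blast

lemma gadget_no_K4:
  assumes "joined w x" "joined w y" "joined w z" "joined x y" "joined x z" "joined y z"
  shows False
proof -
  have "list_all (\<lambda>w. list_all (\<lambda>x. joined w x \<longrightarrow> list_all (\<lambda>y. joined w y \<and> joined x y \<longrightarrow>
      list_all (\<lambda>z. joined w z \<and> joined x z \<longrightarrow> \<not> joined y z) gadget_vertices) gadget_vertices)
      gadget_vertices) gadget_vertices"
    by (simp add: joined_table)
  moreover have "{w, x, y, z} \<subseteq> set gadget_vertices"
    unfolding set_gadget_vertices using assms joined_less by auto
  ultimately show False using assms unfolding list_all_iff by blast
qed

section \<open>The root is forced into the perfect part\<close>

text \<open>
  Induced 5-cycles that avoid the root, each listed in cyclic order. No perfect part contains one of them.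
\<close>

definition pentagons :: "nat list list" where
  "pentagons =
    [[1, 3, 2, 8, 13], [1, 3, 10, 7, 4], [1, 3, 10, 7, 9], [1, 3, 10, 8, 4], [1, 3, 12, 6, 11],
     [1, 3, 12, 6, 13], [1, 4, 7, 6, 5], [1, 4, 8, 2, 9], [1, 5, 6, 2, 9], [1, 5, 6, 7, 9],
     [1, 5, 8, 2, 11], [1, 5, 12, 2, 11], [1, 11, 6, 7, 14], [1, 11, 10, 7, 14], [1, 13, 6, 7, 14],
     [2, 3, 10, 7, 9], [2, 6, 7, 10, 8], [2, 8, 4, 7, 9], [3, 10, 11, 6, 12], [3, 10, 13, 5, 12],
     [3, 10, 13, 5, 14], [4, 7, 6, 5, 8], [5, 6, 11, 9, 14], [5, 12, 7, 10, 13], [5, 13, 10, 7, 14]]"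

text \<open>
  With the root in the triangle-free part, the first 17 of these say that a pair of adjacent neighbours of the root
  is not contained in that part.
\<close>

definition triangles :: "nat list list" where
  "triangles =
    [[0, 1, 3], [0, 1, 4], [0, 1, 5], [0, 1, 9], [0, 2, 3], [0, 2, 6],
     [0, 2, 8], [0, 2, 9], [0, 3, 10], [0, 4, 7], [0, 4, 8], [0, 5, 6],
     [0, 5, 8], [0, 6, 7], [0, 7, 9], [0, 7, 10], [0, 8, 10], [1, 11, 13],
     [3, 12, 14], [5, 12, 14], [6, 11, 13], [7, 12, 14], [10, 11, 13]]"

lemma pentagons_valid:
  assumes "xs \<in> set pentagons"
  shows "length xs = 5" "set xs \<subseteq> {..<15}" "triangle_free gadget (set xs)"
    and "Suc i < 5 \<Longrightarrow> joined (xs ! i) (xs ! Suc i)" "joined (xs ! 4) (xs ! 0)"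
proof -
  have "list_all (\<lambda>xs. length xs = 5 \<and> list_all (\<lambda>j. j < 15) xs \<and> triangle_free_list xs \<and>
     joined (xs ! 0) (xs ! 1) \<and> joined (xs ! 1) (xs ! 2) \<and> joined (xs ! 2) (xs ! 3) \<and>
     joined (xs ! 3) (xs ! 4) \<and> joined (xs ! 4) (xs ! 0)) pentagons"
    by (simp add: pentagons_def triangle_free_list_def joined_table)
  then have *: "length xs = 5" "list_all (\<lambda>j. j < 15) xs" "triangle_free_list xs"
     "joined (xs ! 0) (xs ! 1)" "joined (xs ! 1) (xs ! 2)" "joined (xs ! 2) (xs ! 3)"
     "joined (xs ! 3) (xs ! 4)" "joined (xs ! 4) (xs ! 0)"
    using assms unfolding list_all_iff by blast+
  show "length xs = 5" "set xs \<subseteq> {..<15}" "triangle_free gadget (set xs)" "joined (xs ! 4) (xs ! 0)"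
    using * triangle_free_list by (auto simp: list_all_iff)
  show "joined (xs ! i) (xs ! Suc i)" if "Suc i < 5"
  proof -
    have "i = 0 \<or> i = 1 \<or> i = 2 \<or> i = 3" using that by linarith
    then show ?thesis using *(4-7) by (auto simp: eval_nat_numeral)
  qed
qed

lemma triangles_valid:
  assumes "xs \<in> set triangles"
  obtains x y z where "xs = [x, y, z]" "joined x y" "joined y z" "joined x z"
proof -
  have "list_all (\<lambda>xs. length xs = 3 \<and> joined (xs ! 0) (xs ! 1) \<and> joined (xs ! 1) (xs ! 2) \<and>
     joined (xs ! 0) (xs ! 2)) triangles"
    by (simp add: triangles_def joined_table)
  then have *: "length xs = 3" "joined (xs ! 0) (xs ! 1)" "joined (xs ! 1) (xs ! 2)" "joined (xs ! 0) (xs ! 2)"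
    using assms unfolding list_all_iff by blast+
  then show thesis using that by (auto simp: numeral_3_eq_3 length_Suc_conv)
qed

text \<open>
  With one propositional variable per vertex for membership in \<open>A\<close>, the listed pentagons give clauses that
  require a vertex outside \<open>A\<close> and the listed triangles clauses that require a vertex in \<open>A\<close>. These clauses are
  unsatisfiable when the root is outside \<open>A\<close>.
\<close>

lemma gadget_forces_root:
  assumes "triangle_free gadget ({..<15} - A)"
    and "\<And>xs. xs \<in> set pentagons \<Longrightarrow> \<not> set xs \<subseteq> A"
  shows "0 \<in> A"
proof (rule ccontr)
  assume "0 \<notin> A"
  moreover have "\<forall>xs\<in>set pentagons. \<exists>j\<in>set xs. j \<notin> A"
    using assms(2) by blast
  moreover have "\<forall>xs\<in>set triangles. \<exists>j\<in>set xs. j \<in> A"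
  proof
    fix xs assume "xs \<in> set triangles"
    then obtain x y z where xs: "xs = [x, y, z]" "joined x y" "joined y z" "joined x z"
      by (rule triangles_valid)
    then have "x < 15" "y < 15" "z < 15" using joined_less by auto
    then show "\<exists>j\<in>set xs. j \<in> A"
      using assms(1) xs unfolding triangle_free_def adjacent_gadget by auto
  qed
  ultimately show False
    unfolding pentagons_def triangles_def by simp sat
qed

section \<open>Partitions of the gadget\<close>

text \<open>
  Each vertex is simplicial in the subgraph induced by the vertices that follow it.
\<close>

fun simplicial_order :: "nat list \<Rightarrow> bool" where
  "simplicial_order [] \<longleftrightarrow> True"
| "simplicial_order (x # xs) \<longleftrightarrow> x \<notin> set xs \<and>
     list_all (\<lambda>y. joined x y \<longrightarrow> list_all (\<lambda>z. joined x z \<longrightarrow> y = z \<or> joined y z) xs) xs \<and>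
     simplicial_order xs"

lemma ranked_simplicial_order:
  "simplicial_order xs \<Longrightarrow> \<exists>r. ranked gadget (set xs) r"
proof (induction xs)
  case Nil
  show ?case by (simp add: ranked_def)
next
  case (Cons x xs)
  then obtain r where r: "ranked gadget (set xs) r" by auto
  define m where "m = Suc (Max (insert 0 (r ` set xs)))"
  have m: "r w < m" if "w \<in> set xs" for w
    unfolding m_def using that by (intro le_imp_less_Suc Max_ge) auto
  have x: "x \<notin> set xs" using Cons.prems by simp
  have "clique {w \<in> set (x # xs). adjacent gadget v w \<and> (r(x := m)) w \<le> (r(x := m)) v} (edges gadget)"
    if v: "v \<in> set (x # xs)" for v
  proof (cases "v = x")
    case True
    have "{w \<in> set (x # xs). adjacent gadget v w \<and> (r(x := m)) w \<le> (r(x := m)) v} \<subseteq> {w \<in> set xs. joined x w}"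
      using True joined_irrefl by (auto simp: adjacent_gadget)
    moreover have "clique {w \<in> set xs. joined x w} (edges gadget)"
      using Cons.prems by (auto simp: clique_def adjacent_gadget list_all_iff)
    ultimately show ?thesis using smaller_clique by blast
  next
    case False
    have "{w \<in> set (x # xs). adjacent gadget v w \<and> (r(x := m)) w \<le> (r(x := m)) v}
        \<subseteq> {w \<in> set xs. adjacent gadget v w \<and> r w \<le> r v}"
      using False v m[of v] x by (auto split: if_splits)
    then show ?thesis
      using r False v smaller_clique unfolding ranked_def by (metis (no_types, lifting) set_ConsD)
  qed
  then show ?case unfolding ranked_def by blast
qed

text \<open>
  For \<open>s < 15\<close>, entry \<open>s\<close> is a perfect part, in a simplicial elimination order, for the gadget without \<open>s\<close>; the
  other vertices, among them the root if \<open>s\<close> is not the root, form the triangle-free part. Entry 15 belongs to the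
  intact gadget.
\<close>

definition perfect_parts :: "nat list list" where
  "perfect_parts =
    [[11, 12, 13, 14], [2, 3, 4, 5, 7, 10, 13], [11, 8, 7, 5, 3, 1],
     [1, 2, 5, 7, 8, 13], [11, 7, 9, 5, 8, 3, 2], [12, 10, 6, 4, 2, 9, 1],
     [2, 8, 10, 7, 14, 1], [14, 10, 8, 6, 2, 1], [13, 7, 5, 2, 3, 1],
     [2, 3, 4, 5, 7, 10, 13], [8, 2, 6, 7, 14, 1], [8, 6, 7, 9, 14, 3, 1],
     [1, 2, 5, 7, 8, 10, 13], [8, 6, 7, 9, 14, 3, 1], [1, 2, 5, 7, 8, 10, 13],
     [0, 11, 12, 13, 14]]"

text \<open>
  Here \<open>s\<close> is the deleted vertex, and \<open>s = 15\<close> stands for no deletion. With the intact gadget, the root is in the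
  perfect part without a neighbour there; this isolation lets the perfect parts of several gadgets be joined
  through their roots.
\<close>

lemma gadget_partition:
  assumes "s \<le> 15"
  obtains A r where "A \<subseteq> {..<15}" "s \<notin> A" "ranked gadget A r" "triangle_free gadget ({..<15} - A - {s})"
    "0 \<in> A \<longleftrightarrow> s = 15" "\<And>j. s = 15 \<Longrightarrow> j \<in> A \<Longrightarrow> \<not> joined 0 j"
proof -
  have "list_all (\<lambda>s. let xs = perfect_parts ! s in
      list_all (\<lambda>j. j < 15) xs \<and> s \<notin> set xs \<and> simplicial_order xs \<and>
      triangle_free_list (filter (\<lambda>j. j \<notin> set xs \<and> j \<noteq> s) gadget_vertices) \<and>
      (0 \<in> set xs \<longleftrightarrow> s = 15) \<and> (s = 15 \<longrightarrow> list_all (\<lambda>j. \<not> joined 0 j) xs))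
    (gadget_vertices @ [15])"
    by (simp add: perfect_parts_def triangle_free_list_def joined_table)
  moreover have "s \<in> set (gadget_vertices @ [15])"
    using assms unfolding set_append set_gadget_vertices by auto
  ultimately obtain xs where xs: "list_all (\<lambda>j. j < 15) xs" "s \<notin> set xs" "simplicial_order xs"
      "triangle_free_list (filter (\<lambda>j. j \<notin> set xs \<and> j \<noteq> s) gadget_vertices)"
      "0 \<in> set xs \<longleftrightarrow> s = 15" "s = 15 \<longrightarrow> list_all (\<lambda>j. \<not> joined 0 j) xs"
    unfolding list_all_iff Let_def by blast
  obtain r where "ranked gadget (set xs) r"
    using ranked_simplicial_order[OF xs(3)] by blast
  moreover have "triangle_free gadget ({..<15} - set xs - {s})"
    by (rule triangle_free_subset[OF triangle_free_list[OF xs(4)]])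
       (unfold set_filter set_gadget_vertices, blast)
  ultimately show thesis
    using that[of "set xs"] xs(1,2,5,6) unfolding list_all_iff by blast
qed

section \<open>Triangle-free subsets of the gadget\<close>

text \<open>
  A certificate that all triangle-free subsets of a vertex set are 3-colourable: branch on the vertex of a triangle
  that is missing, remove a vertex that can be coloured last, or finish with three stable classes. Branching is
  needed from the start: the gadget has no 3-colouring and each of its vertices has three pairwise nonadjacent
  neighbours.
\<close>

datatype plan =
    Colour "nat list" "nat list" "nat list"
  | Remove nat plan
  | Branch nat nat nat plan plan plan

definition stable_list :: "nat list \<Rightarrow> bool" where
  "stable_list xs \<longleftrightarrow> list_all (\<lambda>x. list_all (\<lambda>y. \<not> joined x y) xs) xs"

fun valid_plan :: "nat list \<Rightarrow> plan \<Rightarrow> bool" where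
  "valid_plan Y (Colour a b c) \<longleftrightarrow> stable_list a \<and> stable_list b \<and> stable_list c \<and>
     list_all (\<lambda>y. y \<in> set a \<or> y \<in> set b \<or> y \<in> set c) Y"
| "valid_plan Y (Remove v p) \<longleftrightarrow>
     list_all (\<lambda>x. joined v x \<longrightarrow> list_all (\<lambda>y. joined v y \<and> x \<noteq> y \<and> \<not> joined x y \<longrightarrow>
       list_all (\<lambda>z. joined v z \<longrightarrow> x = z \<or> y = z \<or> joined x z \<or> joined y z) Y) Y) Y \<and>
     valid_plan (filter (\<lambda>y. y \<noteq> v) Y) p"
| "valid_plan Y (Branch x y z p q r) \<longleftrightarrow> joined x y \<and> joined y z \<and> joined x z \<and>
     valid_plan (filter (\<lambda>w. w \<noteq> x) Y) p \<and> valid_plan (filter (\<lambda>w. w \<noteq> y) Y) q \<and>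
     valid_plan (filter (\<lambda>w. w \<noteq> z) Y) r"

lemma set_filter_neq: "set (filter (\<lambda>y. y \<noteq> v) Y) = set Y - {v}"
  by auto

lemma valid_plan_sound: "valid_plan Y p \<Longrightarrow> hereditarily_3_colourable gadget (set Y)"
proof (induction p arbitrary: Y)
  case (Colour a b c)
  define f :: "nat \<Rightarrow> nat" where "f = (\<lambda>y. if y \<in> set a then 0 else if y \<in> set b then 1 else 2)"
  have "colouring_on gadget (set Y) 3 f"
    using Colour by (auto simp: colouring_on_def f_def adjacent_gadget stable_list_def list_all_iff) blast
  then show ?case
    unfolding hereditarily_3_colourable_def using colouring_on_subset by blast
next
  case (Remove v p)
  show ?case
  proof (rule hereditarily_3_colourable_remove[OF simple_gadget])
    show "hereditarily_3_colourable gadget (set Y - {v})"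
      using Remove.IH[of "filter (\<lambda>y. y \<noteq> v) Y"] Remove.prems unfolding set_filter_neq by simp
  qed (use Remove.prems in \<open>auto simp: adjacent_gadget list_all_iff\<close>)
next
  case (Branch x y z p q r)
  show ?case
  proof (rule hereditarily_3_colourable_branch)
    show "adjacent gadget x y" "adjacent gadget y z" "adjacent gadget x z"
      using Branch.prems by (simp_all add: adjacent_gadget)
    show "hereditarily_3_colourable gadget (set Y - {x})"
      "hereditarily_3_colourable gadget (set Y - {y})" "hereditarily_3_colourable gadget (set Y - {z})"
      using Branch.IH[of "filter (\<lambda>w. w \<noteq> _) Y"] Branch.prems unfolding set_filter_neq by simp_all
  qed
qed

lemma gadget_hereditarily_3_colourable: "hereditarily_3_colourable gadget {..<15}"
proof -
  have "valid_plan gadget_vertices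
      (Branch 0 6 7
        (Branch 6 7 12
          (Remove 5
          (Remove 13
          (Remove 14
          (Colour [1, 2, 7] [3, 8, 11] [4, 9, 10, 12]))))
          (Remove 4
          (Remove 6
          (Remove 5
          (Remove 8
          (Remove 2
          (Colour [1, 10, 12] [3, 9, 13] [11, 14]))))))
          (Branch 2 6 11
            (Remove 3
            (Remove 9
            (Remove 14
            (Remove 1
            (Remove 5
            (Colour [4, 6, 10] [7, 8, 11] [13]))))))
            (Remove 5
            (Remove 13
            (Remove 14
            (Colour [1, 2, 10] [3, 4, 9] [7, 8, 11]))))
            (Branch 1 3 14
              (Remove 4
              (Remove 9
              (Colour [2, 5, 10] [3, 7, 13] [6, 8, 14])))
              (Remove 10
              (Remove 14
              (Colour [1, 6, 8] [2, 5, 7] [4, 9, 13])))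
              (Branch 8 10 13
                (Colour [1, 6, 10] [2, 5, 7] [3, 4, 9, 13])
                (Colour [1, 6, 8] [2, 5, 7] [3, 4, 9, 13])
                (Colour [1, 2, 7] [3, 6, 8, 9] [4, 5, 10])))))
        (Remove 13
        (Remove 5
        (Remove 14
        (Branch 0 1 3
          (Colour [1, 2, 7] [3, 8, 11] [4, 9, 10, 12])
          (Remove 3
          (Remove 9
          (Colour [0, 11, 12] [2, 4, 10] [7, 8])))
          (Remove 1
          (Remove 9
          (Colour [0, 11, 12] [2, 4, 10] [7, 8])))))))
        (Remove 4
        (Branch 0 3 10
          (Remove 6
          (Remove 5
          (Remove 8
          (Remove 2
          (Colour [1, 10, 12] [3, 9, 13] [11, 14])))))
          (Remove 10
          (Remove 11
          (Remove 9
          (Remove 2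
          (Remove 14
          (Colour [0, 12, 13] [1, 6, 8] [5]))))))
          (Remove 3
          (Remove 11
          (Remove 9
          (Remove 2
          (Remove 14
          (Colour [0, 12, 13] [1, 6, 8] [5])))))))))"
    by (simp add: joined_table stable_list_def)
  then show ?thesis using valid_plan_sound set_gadget_vertices by metis
qed

section \<open>The chain of gadgets\<close>

text \<open>
  Vertex \<open>j\<close> of gadget \<open>i\<close> is encoded as \<open>15 * i + j\<close>, so the roots are the multiples of 15 below \<open>15 * n\<close>. The
  three numbers from \<open>15 * n\<close> on are the apexes \<open>v\<close>, \<open>b\<close> and \<open>c\<close>. All edges are listed with the smaller end first.
\<close>

definition blocks :: "nat \<Rightarrow> (nat \<times> nat) set" where
  "blocks n = {(15 * i + j, 15 * i + k) |i j k. i < n \<and> (j, k) \<in> set gadget_edges}"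

text \<open>
  The path along the roots and the nine edges at the apexes.
\<close>

definition spine :: "nat \<Rightarrow> (nat \<times> nat) set" where
  "spine n = {(15 * i, 15 * Suc i) |i. Suc i < n} \<union>
     {(0, 15 * n), (15 * (n - 1), 15 * n), (15 * n, 15 * n + 1), (15 * n, 15 * n + 2),
      (15 * n + 1, 15 * n + 2), (0, 15 * n + 1), (15 * 3, 15 * n + 1),
      (15 * (n - 4), 15 * n + 2), (15 * (n - 1), 15 * n + 2)}"

definition chain :: "nat \<Rightarrow> nat ugraph" where
  "chain n = \<lparr>verts = {..<15 * n + 3}, edges = {{x, y} |x y. (x, y) \<in> blocks n \<union> spine n}\<rparr>"

definition spine_verts :: "nat \<Rightarrow> nat set" where
  "spine_verts n = (\<lambda>i. 15 * i) ` {..<n} \<union> {15 * n, 15 * n + 1, 15 * n + 2}"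

definition block_part :: "nat set \<Rightarrow> nat \<Rightarrow> nat set" where
  "block_part X i = {j. j < 15 \<and> 15 * i + j \<in> X}"

lemma verts_chain [simp]: "verts (chain n) = {..<15 * n + 3}"
  by (simp add: chain_def)

lemma block_coordinates: "j < 15 \<Longrightarrow> k < 15 \<Longrightarrow> 15 * i + j = 15 * l + k \<longleftrightarrow> i = l \<and> j = k" for i j k l :: nat
proof -
  assume "j < 15" "k < 15"
  then have "(15 * i + j) div 15 = i" "(15 * i + j) mod 15 = j"
    "(15 * l + k) div 15 = l" "(15 * l + k) mod 15 = k"
    by simp_all
  then show ?thesis by metis
qed

lemma gadget_edges_less: "(j, k) \<in> set gadget_edges \<Longrightarrow> j < k \<and> k < 15"
  by (auto simp: gadget_edges_def)

lemma blocks_less: "(x, y) \<in> blocks n \<Longrightarrow> x < y \<and> y < 15 * n"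
proof -
  assume "(x, y) \<in> blocks n"
  then obtain i j k where "i < n" "x = 15 * i + j" "y = 15 * i + k" "(j, k) \<in> set gadget_edges"
    unfolding blocks_def by blast
  then show ?thesis using gadget_edges_less[of j k] by simp
qed

lemma adjacent_chain:
  "adjacent (chain n) x y \<longleftrightarrow> (x, y) \<in> blocks n \<union> spine n \<or> (y, x) \<in> blocks n \<union> spine n"
  by (auto simp: chain_def doubleton_eq_iff)

lemma blocks_iff:
  assumes "i < n" "j < 15" "k < 15"
  shows "(15 * i + j, 15 * i + k) \<in> blocks n \<longleftrightarrow> (j, k) \<in> set gadget_edges"
proof
  assume "(15 * i + j, 15 * i + k) \<in> blocks n"
  then obtain i' j' k' where *: "(j', k') \<in> set gadget_edges" "15 * i + j = 15 * i' + j'" "15 * i + k = 15 * i' + k'"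
    unfolding blocks_def by blast
  then have "j' < 15" "k' < 15" using gadget_edges_less[OF *(1)] by auto
  then show "(j, k) \<in> set gadget_edges"
    using * assms block_coordinates by metis
qed (use assms in \<open>auto simp: blocks_def\<close>)

lemma vertex_cases:
  assumes "x < 15 * n + 3"
  obtains (spine) "x \<in> spine_verts n"
  | (inner) i j where "i < n" "0 < j" "j < 15" "x = 15 * i + j"
proof (cases "x < 15 * n \<and> x mod 15 \<noteq> 0")
  case True
  then have "x div 15 < n" using less_mult_imp_div_less[of x n 15] by (simp add: mult.commute)
  then show thesis using inner[of "x div 15" "x mod 15"] True by simp
next
  case False
  show thesis
  proof (cases "x < 15 * n")
    case True
    then have "x div 15 < n" using less_mult_imp_div_less[of x n 15] by (simp add: mult.commute)
    moreover have "x = 15 * (x div 15)" using False True by (metis div_mult_mod_eq add.right_neutral mult.commute)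
    ultimately show thesis using spine unfolding spine_verts_def by blast
  next
    case False
    then have "x = 15 * n \<or> x = 15 * n + 1 \<or> x = 15 * n + 2" using assms by linarith
    then show thesis using spine unfolding spine_verts_def by blast
  qed
qed

lemma root_in_spine: "i < n \<Longrightarrow> 15 * i \<in> spine_verts n"
  by (simp add: spine_verts_def)

lemma inner_not_spine: "i < n \<Longrightarrow> 0 < j \<Longrightarrow> j < 15 \<Longrightarrow> 15 * i + j \<notin> spine_verts n"
  using block_coordinates[of j 0 i] unfolding spine_verts_def by auto

text \<open>
  An even \<open>n\<close> makes the cycle through \<open>v\<close> and all roots odd. It also excludes \<open>n = 7\<close>, where the roots 3 and
  \<open>n - 4\<close> coincide and would form a triangle with \<open>b\<close> and \<open>c\<close>.
\<close>

context
  fixes n :: nat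
  assumes n: "6 \<le> n" and even: "even n"
begin

lemma spine_less: "(x, y) \<in> spine n \<Longrightarrow> x < y \<and> y < 15 * n + 3"
  using n unfolding spine_def by auto

lemma spine_subset:
  assumes "(x, y) \<in> spine n"
  shows "x \<in> spine_verts n \<and> y \<in> spine_verts n"
proof -
  have "15 * 0 \<in> spine_verts n" "15 * 3 \<in> spine_verts n" "15 * (n - 1) \<in> spine_verts n"
    "15 * (n - 4) \<in> spine_verts n"
    using n by (intro root_in_spine, simp)+
  moreover have "15 * n \<in> spine_verts n" "15 * n + 1 \<in> spine_verts n" "15 * n + 2 \<in> spine_verts n"
    by (simp_all add: spine_verts_def)
  moreover have "15 * i \<in> spine_verts n" "15 * Suc i \<in> spine_verts n" if "Suc i < n" for i
    using that by (intro root_in_spine, simp)+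
  ultimately show ?thesis using assms unfolding spine_def by auto
qed

lemma simple_chain: "simple_graph (chain n)"
proof -
  have "x < y \<and> y < 15 * n + 3" if "(x, y) \<in> blocks n \<union> spine n" for x y
    using that blocks_less spine_less by fastforce
  then show ?thesis unfolding simple_graph_def chain_def by fastforce
qed

lemma adjacent_block:
  assumes "i < n" "j < 15" "k < 15"
  shows "adjacent (chain n) (15 * i + j) (15 * i + k) \<longleftrightarrow> joined j k"
proof -
  have no: "(15 * i + j, 15 * i + k) \<notin> spine n" if "j < 15" "k < 15" for j k
  proof
    assume *: "(15 * i + j, 15 * i + k) \<in> spine n"
    then have "15 * i + j \<in> spine_verts n" "15 * i + k \<in> spine_verts n" using spine_subset by blast+
    then have "j = 0" "k = 0" using inner_not_spine[OF assms(1)] that by blast+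
    then show False using spine_less[OF *] by simp
  qed
  show ?thesis
    using assms no blocks_iff unfolding adjacent_chain joined_def by simp
qed

text \<open>
  A vertex other than a root meets the rest of the graph only inside its own gadget. Hence triangles, cliques and
  edges live either in one gadget or among the roots and apexes.
\<close>

lemma inner_neighbour:
  assumes "i < n" "0 < j" "j < 15" "adjacent (chain n) (15 * i + j) y"
  obtains k where "k < 15" "y = 15 * i + k" "joined j k"
proof -
  have "(15 * i + j, y) \<notin> spine n" "(y, 15 * i + j) \<notin> spine n"
    using inner_not_spine[OF assms(1-3)] spine_subset by blast+
  then have "(15 * i + j, y) \<in> blocks n \<or> (y, 15 * i + j) \<in> blocks n"
    using assms(4) by (auto simp: adjacent_chain)
  then obtain i' j' k' where *: "j' < 15" "k' < 15" "15 * i + j = 15 * i' + j'" "y = 15 * i' + k'"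
  proof (elim disjE)
    assume "(15 * i + j, y) \<in> blocks n"
    then obtain i' j' k' where "(j', k') \<in> set gadget_edges" "15 * i + j = 15 * i' + j'" "y = 15 * i' + k'"
      unfolding blocks_def by blast
    then show thesis using that[of j' k' i'] gadget_edges_less[of j' k'] by simp
  next
    assume "(y, 15 * i + j) \<in> blocks n"
    then obtain i' j' k' where "(j', k') \<in> set gadget_edges" "y = 15 * i' + j'" "15 * i + j = 15 * i' + k'"
      unfolding blocks_def by blast
    then show thesis using that[of k' j' i'] gadget_edges_less[of j' k'] by simp
  qed
  then have "i = i'" "j = j'" using block_coordinates[OF assms(3) *(1)] by blast+
  then show thesis
    using that[OF *(2)] * assms adjacent_block by blast
qed

lemma adjacent_spine:
  assumes "x \<in> spine_verts n" "y \<in> spine_verts n"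
  shows "adjacent (chain n) x y \<longleftrightarrow> (x, y) \<in> spine n \<or> (y, x) \<in> spine n"
proof -
  have "(x, y) \<notin> blocks n" if xy: "x \<in> spine_verts n" "y \<in> spine_verts n" for x y
  proof
    assume "(x, y) \<in> blocks n"
    then obtain i j k where *: "i < n" "x = 15 * i + j" "y = 15 * i + k" "(j, k) \<in> set gadget_edges"
      unfolding blocks_def by blast
    then have "0 < k" "k < 15" using gadget_edges_less[OF *(4)] by auto
    then show False using inner_not_spine[OF *(1)] xy * by blast
  qed
  then show ?thesis using assms by (auto simp: adjacent_chain)
qed

lemma triangle_in_block_or_spine:
  assumes "adjacent (chain n) x y" "adjacent (chain n) y z" "adjacent (chain n) x z"
  obtains (spine) "x \<in> spine_verts n" "y \<in> spine_verts n" "z \<in> spine_verts n"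
  | (block) i a b c where "i < n" "a < 15" "b < 15" "c < 15"
      "x = 15 * i + a" "y = 15 * i + b" "z = 15 * i + c"
proof -
  have in_verts: "x < 15 * n + 3" "y < 15 * n + 3" "z < 15 * n + 3"
    using assms simple_chain unfolding simple_graph_def by fastforce+
  note sym = assms[THEN adjacent_sym]
  show thesis
    using in_verts(1)
  proof (cases rule: vertex_cases)
    case inner
    then show thesis using block inner_neighbour assms by metis
  next
    case x: spine
    show thesis
      using in_verts(2)
    proof (cases rule: vertex_cases)
      case inner
      then show thesis using block inner_neighbour assms(2) sym(1) by metis
    next
      case y: spine
      show thesis
        using in_verts(3)
      proof (cases rule: vertex_cases)
        case inner
        then show thesis using block inner_neighbour sym(2,3) by metis
      next
        case z: spine
        then show thesis using spine x y by blast
      qed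
    qed
  qed
qed

lemma triangle_free_chainI:
  assumes "\<And>i. i < n \<Longrightarrow> triangle_free gadget (block_part X i)"
    and "triangle_free (chain n) (X \<inter> spine_verts n)"
  shows "triangle_free (chain n) X"
proof (rule triangle_freeI)
  fix x y z
  assume X: "x \<in> X" "y \<in> X" "z \<in> X"
    and adj: "adjacent (chain n) x y" "adjacent (chain n) y z" "adjacent (chain n) x z"
  from adj show False
  proof (cases rule: triangle_in_block_or_spine)
    case spine
    then show False using assms(2) X adj triangle_freeD by (metis IntI)
  next
    case (block i a b c)
    then have "a \<in> block_part X i" "b \<in> block_part X i" "c \<in> block_part X i"
      using X by (auto simp: block_part_def)
    moreover have "joined a b" "joined b c" "joined a c"
      using adj block adjacent_block by auto
    ultimately show False
      using assms(1)[OF block(1)] unfolding triangle_free_def adjacent_gadget by blast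
  qed
qed

lemma triangle_free_block_part:
  assumes "triangle_free (chain n) X" "i < n"
  shows "triangle_free gadget (block_part X i)"
proof (rule triangle_freeI)
  fix a b c
  assume *: "a \<in> block_part X i" "b \<in> block_part X i" "c \<in> block_part X i"
    and "adjacent gadget a b" "adjacent gadget b c" "adjacent gadget a c"
  then show False
    using triangle_freeD[OF assms(1), of "15 * i + a" "15 * i + b" "15 * i + c"] adjacent_block[OF assms(2)]
    by (auto simp: block_part_def adjacent_gadget)
qed

text \<open>
  Among the roots, \<open>b\<close> and \<open>c\<close> there is no triangle. Edges are oriented upwards, so it is enough to look at the largest
  vertex \<open>z\<close> of a triangle and at the few smaller vertices joined to it.
\<close>

lemma no_spine_triangle_sorted:
  assumes "(x, y) \<in> spine n" "(y, z) \<in> spine n" "(x, z) \<in> spine n"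
  shows "15 * n \<in> {x, y, z}"
proof (rule ccontr)
  assume "\<not> ?thesis"
  then have ne: "x \<noteq> 15 * n" "y \<noteq> 15 * n" "z \<noteq> 15 * n" by auto
  have xy: "y = 15 * n + 2 \<or> (y = 15 * n + 1 \<and> (x = 0 \<or> x = 45)) \<or> y = x + 15"
    using assms(1) ne unfolding spine_def by auto
  have yz: "(z < 15 * n \<and> z = y + 15) \<or> (z = 15 * n + 1 \<and> (y = 0 \<or> y = 45)) \<or>
      (z = 15 * n + 2 \<and> (y = 15 * n + 1 \<or> y = 15 * (n - 4) \<or> y = 15 * (n - 1)))"
    using assms(2) ne unfolding spine_def by auto
  have xz: "z = x + 15 \<or> (z = 15 * n + 1 \<and> (x = 0 \<or> x = 45)) \<or>
      (z = 15 * n + 2 \<and> (x = 15 * n + 1 \<or> x = 15 * (n - 4) \<or> x = 15 * (n - 1)))"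
    using assms(3) ne unfolding spine_def by auto
  have lt: "x < y" "y < z" using spine_less assms by blast+
  obtain m where m: "n = m + 4" "2 \<le> m" using n that[of "n - 4"] by simp
  have "m \<noteq> 3" using even m by auto
  note facts = xy xz lt m \<open>m \<noteq> 3\<close>
  from yz consider "z < 15 * n" "z = y + 15" | "z = 15 * n + 1" "y = 0 \<or> y = 45"
    | "z = 15 * n + 2" "y = 15 * n + 1" | "z = 15 * n + 2" "y = 15 * (n - 4)"
    | "z = 15 * n + 2" "y = 15 * (n - 1)"
    by blast
  then show False
  proof cases
    case 1
    then show False using facts by (elim disjE conjE) linarith+
  next
    case 2
    then show False using facts by (elim disjE conjE) linarith+
  next
    case 3
    then show False using facts by (elim disjE conjE) linarith+
  next
    case 4
    then show False using facts by (elim disjE conjE) linarith+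
  next
    case 5
    then show False using facts by (elim disjE conjE) linarith+
  qed
qed

lemma spine_triangle:
  assumes "x \<in> spine_verts n" "y \<in> spine_verts n" "z \<in> spine_verts n"
    and "adjacent (chain n) x y" "adjacent (chain n) y z" "adjacent (chain n) x z"
  shows "15 * n \<in> {x, y, z}"
proof -
  have e: "(x, y) \<in> spine n \<or> (y, x) \<in> spine n" "(y, z) \<in> spine n \<or> (z, y) \<in> spine n"
    "(x, z) \<in> spine n \<or> (z, x) \<in> spine n"
    using assms adjacent_spine by blast+
  have "x < y \<or> y < x" "y < z \<or> z < y" "x < z \<or> z < x"
    using e spine_less by blast+
  then show ?thesis
    using e no_spine_triangle_sorted spine_less by (smt (verit) insert_iff singletonD less_asym less_trans)
qed

lemma finite_in_chain: "A \<subseteq> verts (chain n) \<Longrightarrow> finite A"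
  using finite_subset by fastforce

lemma apex_in_spine: "15 * n \<in> spine_verts n" "15 * n + 1 \<in> spine_verts n" "15 * n + 2 \<in> spine_verts n"
  by (simp_all add: spine_verts_def)

lemma adjacent_consecutive_roots:
  assumes "Suc i < n"
  shows "adjacent (chain n) (15 * i) (15 * Suc i)"
proof -
  have "(15 * i, 15 * Suc i) \<in> spine n"
    unfolding spine_def using assms by (intro UnI1) blast
  then show ?thesis by (simp add: adjacent_chain)
qed

lemma adjacent_roots:
  assumes "i < n" "k < n" "adjacent (chain n) (15 * i) (15 * k)"
  shows "k = Suc i \<or> i = Suc k"
proof -
  have "(15 * i, 15 * k) \<in> spine n \<or> (15 * k, 15 * i) \<in> spine n"
    using adjacent_spine[OF root_in_spine root_in_spine] assms by blast
  then show ?thesis using assms(1,2) unfolding spine_def by auto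
qed

lemma adjacent_apexes:
  "adjacent (chain n) (15 * n) (15 * n + 1)" "adjacent (chain n) (15 * n) (15 * n + 2)"
  "adjacent (chain n) (15 * n + 1) (15 * n + 2)"
  by (simp_all add: adjacent_chain spine_def)

lemma adjacent_apex_root:
  assumes "i < n"
  shows "adjacent (chain n) (15 * n) (15 * i) \<longleftrightarrow> i = 0 \<or> i = n - 1"
    and "adjacent (chain n) (15 * n + 1) (15 * i) \<longleftrightarrow> i = 0 \<or> i = 3"
    and "adjacent (chain n) (15 * n + 2) (15 * i) \<longleftrightarrow> i = n - 4 \<or> i = n - 1"
proof -
  note spine = adjacent_spine[OF apex_in_spine(1) root_in_spine[OF assms]]
    adjacent_spine[OF apex_in_spine(2) root_in_spine[OF assms]]
    adjacent_spine[OF apex_in_spine(3) root_in_spine[OF assms]]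
  show "adjacent (chain n) (15 * n) (15 * i) \<longleftrightarrow> i = 0 \<or> i = n - 1"
    and "adjacent (chain n) (15 * n + 1) (15 * i) \<longleftrightarrow> i = 0 \<or> i = 3"
    and "adjacent (chain n) (15 * n + 2) (15 * i) \<longleftrightarrow> i = n - 4 \<or> i = n - 1"
    unfolding spine using assms n unfolding spine_def by auto
qed

lemma root_neighbour:
  assumes "i < n" "adjacent (chain n) (15 * i) y"
  obtains (block) k where "0 < k" "k < 15" "y = 15 * i + k" "joined 0 k"
  | (root) k where "k < n" "y = 15 * k" "k = Suc i \<or> i = Suc k"
  | (v) "y = 15 * n" "i = 0 \<or> i = n - 1"
  | (b) "y = 15 * n + 1" "i = 0 \<or> i = 3"
  | (c) "y = 15 * n + 2" "i = n - 4 \<or> i = n - 1"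
proof -
  have "y < 15 * n + 3"
    using simple_chain assms(2) unfolding simple_graph_def by fastforce
  then show thesis
  proof (cases rule: vertex_cases)
    case spine
    then consider k where "k < n" "y = 15 * k" | "y = 15 * n" | "y = 15 * n + 1" | "y = 15 * n + 2"
      unfolding spine_verts_def by blast
    then show thesis
    proof cases
      case (1 k)
      then have "adjacent (chain n) (15 * i) (15 * k)" using assms(2) by simp
      then show thesis using root[OF 1] adjacent_roots[OF assms(1) 1(1)] by simp
    next
      case 2
      then have "adjacent (chain n) (15 * n) (15 * i)" using adjacent_sym[OF assms(2)] by simp
      then show thesis using v[OF 2] adjacent_apex_root(1)[OF assms(1)] by simp
    next
      case 3
      then have "adjacent (chain n) (15 * n + 1) (15 * i)" using adjacent_sym[OF assms(2)] by simp
      then show thesis using b[OF 3] adjacent_apex_root(2)[OF assms(1)] by simp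
    next
      case 4
      then have "adjacent (chain n) (15 * n + 2) (15 * i)" using adjacent_sym[OF assms(2)] by simp
      then show thesis using c[OF 4] adjacent_apex_root(3)[OF assms(1)] by simp
    qed
  next
    case (inner l k)
    have "adjacent (chain n) (15 * l + k) (15 * i)" using adjacent_sym[OF assms(2)] inner(4) by simp
    then obtain m where m: "m < 15" "15 * i = 15 * l + m" "joined k m"
      using inner_neighbour[OF inner(1-3)] by blast
    then have "i = l" "m = 0" using block_coordinates[of 0 m i l] by auto
    then show thesis using block inner m joined_sym by blast
  qed
qed

section \<open>A chain has no division\<close>

text \<open>
  A triangle among roots and apexes contains \<open>v\<close>, and the only two roots joined to \<open>v\<close> are the ends of the path.
\<close>

lemma triangle_free_apex_roots:
  "triangle_free (chain n) (insert a ((\<lambda>i. 15 * i) ` {..<n}))" if "a \<in> spine_verts n"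
proof (rule triangle_freeI)
  let ?X = "insert a ((\<lambda>i. 15 * i) ` {..<n})"
  fix x y z
  assume X: "x \<in> ?X" "y \<in> ?X" "z \<in> ?X"
    and adj: "adjacent (chain n) x y" "adjacent (chain n) y z" "adjacent (chain n) x z"
  have "?X \<subseteq> spine_verts n" using that root_in_spine by auto
  then have top: "15 * n \<in> {x, y, z}" using spine_triangle X adj by blast
  have no_edge: False
    if "i < n" "k < n" "adjacent (chain n) (15 * n) (15 * i)" "adjacent (chain n) (15 * n) (15 * k)"
      "adjacent (chain n) (15 * i) (15 * k)" for i k
  proof -
    have "i = 0 \<or> i = n - 1" "k = 0 \<or> k = n - 1" "k = Suc i \<or> i = Suc k"
      using adjacent_apex_root(1) adjacent_roots that by blast+
    then show False using n by auto
  qed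
  have "a = 15 * n" using top X by auto
  then have root: "\<exists>i<n. w = 15 * i" if "w \<in> ?X" "w \<noteq> 15 * n" for w
    using that by auto
  have no_triangle_at_apex: False
    if qs: "q \<in> ?X" "s \<in> ?X" "adjacent (chain n) (15 * n) q" "adjacent (chain n) (15 * n) s"
      "adjacent (chain n) q s" for q s
  proof -
    have "q \<noteq> 15 * n" "s \<noteq> 15 * n"
      using adjacent_neq[OF simple_chain] qs(3,4) by blast+
    then obtain i k where "i < n" "q = 15 * i" "k < n" "s = 15 * k" using root qs(1,2) by blast
    then show False using no_edge qs(3-5) by blast
  qed
  from top consider "x = 15 * n" | "y = 15 * n" | "z = 15 * n" by blast
  then show False
  proof cases
    case 1
    then show False using no_triangle_at_apex[OF X(2,3)] adj by blast
  next
    case 2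
    then show False using no_triangle_at_apex[OF X(1,3)] adj adjacent_sym[OF adj(1)] by blast
  next
    case 3
    then show False
      using no_triangle_at_apex[OF X(1,2)] adj adjacent_sym[OF adj(2)] adjacent_sym[OF adj(3)] by blast
  qed
qed

text \<open>
  An apex joined to two roots at odd distance along the path closes an odd cycle with the segment between them.
\<close>

lemma no_apex_cycle_in_perfect:
  assumes A: "A \<subseteq> verts (chain n)" and perf: "perfect (induced (chain n) A)"
    and roots: "\<And>i. i < n \<Longrightarrow> 15 * i \<in> A" and a: "a \<in> A" "a \<in> spine_verts n"
    and ends: "i \<le> k" "k < n" "odd (k - i)"
      "adjacent (chain n) a (15 * i)" "adjacent (chain n) a (15 * k)"
  shows False
proof -
  define x where "x m = (if m = 0 then a else 15 * (i + m - 1))" for m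
  let ?L = "k - i + 2"
  have range: "x m \<in> insert a ((\<lambda>i. 15 * i) ` {i..k})" if "m < ?L" for m
  proof (cases "m = 0")
    case False
    then have "i + m - 1 \<in> {i..k}" using that ends(1) by auto
    then show ?thesis using False by (simp add: x_def)
  qed (simp add: x_def)
  show False
  proof (rule no_odd_hole_in_perfect[OF simple_chain finite_in_chain[OF A] perf, of x ?L])
    show "x ` {..<?L} \<subseteq> A" using range roots a(1) ends(2) by fastforce
    have "x ` {..<?L} \<subseteq> insert a ((\<lambda>i. 15 * i) ` {..<n})" using range ends(2) by fastforce
    then show "triangle_free (chain n) (x ` {..<?L})"
      using triangle_free_apex_roots[OF a(2)] triangle_free_subset by blast
    show "odd ?L" using ends(3) by simp
    show "adjacent (chain n) (x m) (x (Suc m))" if "Suc m < ?L" for m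
    proof (cases m)
      case 0
      then show ?thesis using ends(4) by (simp add: x_def)
    next
      case (Suc l)
      then have "Suc (i + l) < n" using that ends(1,2) by linarith
      then show ?thesis using adjacent_consecutive_roots[of "i + l"] Suc by (simp add: x_def)
    qed
    have "x (?L - 1) = 15 * k" using ends(1) by (simp add: x_def)
    then show "adjacent (chain n) (x (?L - 1)) (x 0)"
      using adjacent_sym[OF ends(5)] by (simp add: x_def)
  qed
qed

text \<open>
  The roots are forced into \<open>A\<close> by their gadgets. Each apex then closes an odd cycle with a segment of roots, so the
  triangle of the apexes lies in \<open>B\<close>.
\<close>

lemma chain_indivisible:
  assumes AB: "A \<union> B = verts (chain n)" "A \<inter> B = {}"
    and perf: "perfect (induced (chain n) A)" and tf: "triangle_free (chain n) B"
  shows False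
proof -
  have A: "A \<subseteq> verts (chain n)" using AB(1) by blast
  have roots: "15 * i \<in> A" if i: "i < n" for i
  proof -
    have "15 * i + j \<in> A \<union> B" if "j < 15" for j
      unfolding AB(1) using i that by simp
    then have "{..<15} - block_part A i \<subseteq> block_part B i"
      by (force simp: block_part_def)
    then have tf': "triangle_free gadget ({..<15} - block_part A i)"
      using triangle_free_block_part[OF tf i] triangle_free_subset by blast
    have "\<not> set xs \<subseteq> block_part A i" if xs: "xs \<in> set pentagons" for xs
    proof
      assume sub: "set xs \<subseteq> block_part A i"
      note valid = pentagons_valid[OF xs]
      define x where "x m = 15 * i + xs ! m" for m
      have lt: "xs ! m < 15" if "m < 5" for m
        using nth_mem[of m xs] that valid(1,2) by (metis lessThan_iff subsetD)
      have img: "x ` {..<5} = (\<lambda>j. 15 * i + j) ` set xs"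
      proof -
        have "set xs = (\<lambda>m. xs ! m) ` {..<length xs}" by (auto simp: set_conv_nth)
        then show ?thesis unfolding x_def valid(1) by (simp only: image_image)
      qed
      show False
      proof (rule no_odd_hole_in_perfect[OF simple_chain finite_in_chain[OF A] perf, of x 5])
        show "x ` {..<5} \<subseteq> A" using sub unfolding img by (auto simp: block_part_def)
        show "triangle_free (chain n) (x ` {..<5})"
        proof (rule triangle_freeI)
          fix u v w
          assume "u \<in> x ` {..<5}" "v \<in> x ` {..<5}" "w \<in> x ` {..<5}"
            and adj: "adjacent (chain n) u v" "adjacent (chain n) v w" "adjacent (chain n) u w"
          then obtain a b c where abc: "a \<in> set xs" "b \<in> set xs" "c \<in> set xs"
              "u = 15 * i + a" "v = 15 * i + b" "w = 15 * i + c"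
            unfolding img by (elim imageE)
          then have "a < 15" "b < 15" "c < 15" using valid(2) by auto
          then have "joined a b" "joined b c" "joined a c"
            using adjacent_block[OF i] adj abc by auto
          then show False using valid(3) abc unfolding triangle_free_def adjacent_gadget by blast
        qed
        show "adjacent (chain n) (x m) (x (Suc m))" if "Suc m < 5" for m
          unfolding x_def using adjacent_block[OF i] lt valid(4) that by simp
        show "adjacent (chain n) (x (5 - 1)) (x 0)"
          unfolding x_def using adjacent_block[OF i] lt valid(5) by simp
      qed simp
    qed
    then have "0 \<in> block_part A i" using gadget_forces_root[OF tf'] by blast
    then show ?thesis by (simp add: block_part_def)
  qed
  have apexes: "15 * n \<in> A \<union> B" "15 * n + 1 \<in> A \<union> B" "15 * n + 2 \<in> A \<union> B"
    unfolding AB(1) by simp_all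
  note no_cycle = no_apex_cycle_in_perfect[OF A perf roots]
  have "15 * n \<in> B"
  proof (rule ccontr)
    assume "15 * n \<notin> B"
    then have "15 * n \<in> A" using apexes by blast
    then show False
      using no_cycle[OF _ _ apex_in_spine(1), of 0 "n - 1"] n even
        adjacent_apex_root(1)[of 0] adjacent_apex_root(1)[of "n - 1"] by simp
  qed
  moreover have "15 * n + 1 \<in> B"
  proof (rule ccontr)
    assume "15 * n + 1 \<notin> B"
    then have "15 * n + 1 \<in> A" using apexes by blast
    then show False
      using no_cycle[OF _ _ apex_in_spine(2), of 0 3] n
        adjacent_apex_root(2)[of 0] adjacent_apex_root(2)[of 3] by simp
  qed
  moreover have "15 * n + 2 \<in> B"
  proof (rule ccontr)
    assume "15 * n + 2 \<notin> B"
    then have "15 * n + 2 \<in> A" using apexes by blast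
    then show False
      using no_cycle[OF _ _ apex_in_spine(3), of "n - 4" "n - 1"] n
        adjacent_apex_root(3)[of "n - 4"] adjacent_apex_root(3)[of "n - 1"] diff_le_mono2[of 1 4 n] by simp
  qed
  ultimately show False
    using triangle_freeD[OF tf _ _ _ adjacent_apexes(1,3,2)] by blast
qed

section \<open>A chain without one vertex\<close>

text \<open>
  The gadget \<open>i0\<close> loses its vertex \<open>s\<close> and every other gadget is intact; \<open>i0 = n\<close> means that no gadget is touched. Then
  all roots except that of gadget \<open>i0\<close> can be in the perfect part. If the path is broken at gadget \<open>i0\<close>, the
  apex \<open>v\<close> can join them.
\<close>

lemma chain_partition:
  assumes i0: "i0 \<le> n" and s: "s \<le> 15" "s = 15 \<longleftrightarrow> i0 = n"
  obtains A where "A \<subseteq> verts (chain n)" "perfect (induced (chain n) A)"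
    "\<And>k. k < n \<Longrightarrow> triangle_free gadget ({..<15} - block_part A k - (if k = i0 then {s} else {}))"
    "\<And>k. k < n \<Longrightarrow> 15 * k \<in> A \<longleftrightarrow> k \<noteq> i0" "15 * n \<in> A \<longleftrightarrow> i0 < n"
    "15 * n + 1 \<notin> A" "15 * n + 2 \<notin> A" "i0 < n \<Longrightarrow> 15 * i0 + s \<notin> A"
proof -
  have "\<forall>s. \<exists>A r. s \<le> 15 \<longrightarrow> A \<subseteq> {..<15} \<and> s \<notin> A \<and> ranked gadget A r \<and>
      triangle_free gadget ({..<15} - A - {s}) \<and> (0 \<in> A \<longleftrightarrow> s = 15) \<and>
      (\<forall>j. s = 15 \<longrightarrow> j \<in> A \<longrightarrow> \<not> joined 0 j)"
    by (metis gadget_partition)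
  from choice[OF this] obtain P where
    "\<forall>s. \<exists>r. s \<le> 15 \<longrightarrow> P s \<subseteq> {..<15} \<and> s \<notin> P s \<and> ranked gadget (P s) r \<and>
      triangle_free gadget ({..<15} - P s - {s}) \<and> (0 \<in> P s \<longleftrightarrow> s = 15) \<and>
      (\<forall>j. s = 15 \<longrightarrow> j \<in> P s \<longrightarrow> \<not> joined 0 j)"
    by blast
  from choice[OF this] obtain r where
    "\<forall>s. s \<le> 15 \<longrightarrow> P s \<subseteq> {..<15} \<and> s \<notin> P s \<and> ranked gadget (P s) (r s) \<and>
      triangle_free gadget ({..<15} - P s - {s}) \<and> (0 \<in> P s \<longleftrightarrow> s = 15) \<and>
      (\<forall>j. s = 15 \<longrightarrow> j \<in> P s \<longrightarrow> \<not> joined 0 j)"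
    by blast
  then have P: "\<And>s. s \<le> 15 \<Longrightarrow> P s \<subseteq> {..<15}" "\<And>s. s \<le> 15 \<Longrightarrow> s \<notin> P s"
      "\<And>s. s \<le> 15 \<Longrightarrow> ranked gadget (P s) (r s)"
      "\<And>s. s \<le> 15 \<Longrightarrow> triangle_free gadget ({..<15} - P s - {s})"
      "\<And>s. s \<le> 15 \<Longrightarrow> 0 \<in> P s \<longleftrightarrow> s = 15" "\<And>j. j \<in> P 15 \<Longrightarrow> \<not> joined 0 j"
    by simp_all (metis order.refl)
  define st where "st k = (if k = i0 then s else 15)" for k
  have st: "st k \<le> 15" for k using s by (simp add: st_def)
  have st15: "st k = 15 \<longleftrightarrow> k \<noteq> i0" if "k < n" for k using s i0 that by (auto simp: st_def)
  define A where "A = {15 * k + j |k j. k < n \<and> j \<in> P (st k)} \<union> (if i0 < n then {15 * n} else {})"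
  have P15: "j < 15" if "j \<in> P (st k)" for j k using P(1)[OF st] that by blast
  have in_A: "15 * k + j \<in> A \<longleftrightarrow> j \<in> P (st k)" if kj: "k < n" "j < 15" for k j
  proof
    assume "15 * k + j \<in> A"
    moreover have "15 * k + j \<noteq> 15 * n" using kj by simp
    ultimately obtain k' j' where *: "15 * k + j = 15 * k' + j'" "j' \<in> P (st k')"
      unfolding A_def by (auto split: if_splits)
    have "k = k'" "j = j'" using block_coordinates[OF kj(2) P15[OF *(2)], of k k'] *(1) by simp_all
    then show "j \<in> P (st k)" using *(2) by simp
  qed (use kj in \<open>auto simp: A_def\<close>)
  have root_A: "15 * k \<in> A \<longleftrightarrow> k \<noteq> i0" if "k < n" for k
    using in_A[of k 0] P(5)[OF st] st15[OF that] that by simp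
  have top_A: "x \<in> A \<longleftrightarrow> x = 15 * n \<and> i0 < n" if "15 * n \<le> x" for x
  proof -
    have "x \<noteq> 15 * k + j" if "k < n" "j \<in> P (st k)" for k j
      using that P15[OF that(2)] \<open>15 * n \<le> x\<close> by simp
    then show ?thesis unfolding A_def by auto
  qed
  have part: "block_part A k = P (st k)" if "k < n" for k
    using in_A[OF that] P15 unfolding block_part_def by blast
  have A: "A \<subseteq> verts (chain n)"
  proof
    fix x assume "x \<in> A"
    then consider "x = 15 * n" | k j where "k < n" "j \<in> P (st k)" "x = 15 * k + j"
      unfolding A_def by (auto split: if_splits)
    then show "x \<in> verts (chain n)"
    proof cases
      case (2 k j)
      then show ?thesis using P15[OF 2(2)] by simp
    qed simp
  qed

  \<comment> \<open>On roots and \<open>v\<close>, the ranks increase along the path that starts after root \<open>i0\<close>, goes up to the last root, passes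
    through \<open>v\<close> and continues from the first root to the one before \<open>i0\<close>. For \<open>i0 = n\<close> it is the whole path of roots.\<close>
  define R where "R x = (if x = 15 * n then n else if x mod 15 = 0
      then (if x div 15 < i0 then n + 1 + x div 15 else x div 15)
      else r (st (x div 15)) (x mod 15))" for x
  have R_top: "R (15 * n) = n" by (simp add: R_def)
  have R_root: "R (15 * k) = (if k < i0 then n + 1 + k else k)" if "k < n" for k
    using that by (simp add: R_def)
  have R_inner: "R (15 * k + j) = r (st k) j" if "k < n" "0 < j" "j < 15" for k j
    using that by (simp add: R_def)

  have "perfect (induced (chain n) A)"
  proof (rule perfect_if_ranked[OF simple_chain finite_in_chain[OF A]], unfold ranked_def, intro ballI)
    fix v assume v: "v \<in> A"
    let ?W = "{w \<in> A. adjacent (chain n) v w \<and> R w \<le> R v}"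
    have single: "clique ?W (edges (chain n))" if "\<And>w. w \<in> ?W \<Longrightarrow> w = p" for p
      using that unfolding clique_def by blast
    from v consider (apex) "v = 15 * n" "i0 < n" | (block) k j where "k < n" "j \<in> P (st k)" "v = 15 * k + j"
      unfolding A_def by (auto split: if_splits)
    then show "clique ?W (edges (chain n))"
    proof cases
      case apex
      show ?thesis
      proof (rule single[of "15 * (n - 1)"])
        fix w assume "w \<in> ?W"
        then have w: "w \<in> A" "adjacent (chain n) (15 * n) w" "R w \<le> n" using apex R_top by auto
        have "w < 15 * n + 3" using A w(1) by auto
        moreover have "w \<noteq> 15 * n" using adjacent_neq[OF simple_chain w(2)] by simp
        ultimately have "w < 15 * n" using top_A[of w] w(1) by linarith
        from \<open>w < 15 * n + 3\<close> show "w = 15 * (n - 1)"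
        proof (cases rule: vertex_cases)
          case spine
          then obtain k where k: "k < n" "w = 15 * k"
            using \<open>w < 15 * n\<close> unfolding spine_verts_def by auto
          have "k \<noteq> i0" using w(1) root_A k by blast
          have "k = 0 \<or> k = n - 1" using w(2) k adjacent_apex_root(1)[OF k(1)] by simp
          moreover have "k \<noteq> 0" using w(3) R_root[OF k(1)] k(2) \<open>k \<noteq> i0\<close> by (auto split: if_splits)
          ultimately show ?thesis using k by simp
        next
          case (inner i j)
          then have "adjacent (chain n) (15 * i + j) (15 * n)" using adjacent_sym[OF w(2)] by simp
          then obtain k where "k < 15" "15 * n = 15 * i + k"
            using inner_neighbour[OF inner(1-3)] by blast
          then show ?thesis using inner(1) by simp
        qed
      qed
    next
      case (block k j)
      show ?thesis
      proof (cases "j = 0")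
        case True
        then have v: "v = 15 * k" using block by simp
        have k: "k \<noteq> i0" "st k = 15" using True block P(5)[OF st, of k] st15[OF block(1)] by auto
        have W: "(\<exists>l<n. l \<noteq> i0 \<and> w = 15 * l \<and> (l = Suc k \<or> k = Suc l) \<and> R (15 * l) \<le> R (15 * k)) \<or>
            (w = 15 * n \<and> i0 < n \<and> (k = 0 \<or> k = n - 1) \<and> R (15 * n) \<le> R (15 * k))"
          if "w \<in> ?W" for w
        proof -
          have w: "w \<in> A" "adjacent (chain n) (15 * k) w" "R w \<le> R (15 * k)" using that v by auto
          from block(1) w(2) show ?thesis
          proof (cases rule: root_neighbour)
            case (block m)
            then have "m \<in> P 15" using w(1) in_A[OF \<open>k < n\<close>, of m] k(2) by simp
            then show ?thesis using P(6) block by blast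
          next
            case (root l)
            then show ?thesis using w root_A by auto
          next
            case v
            then show ?thesis using w top_A[of w] by auto
          next
            case b
            then show ?thesis using w top_A[of w] by auto
          next
            case c
            then show ?thesis using w top_A[of w] by auto
          qed
        qed
        show ?thesis
        proof (rule single[of "if k = 0 then 15 * n else 15 * (k - 1)"])
          fix w assume "w \<in> ?W"
          from W[OF this] show "w = (if k = 0 then 15 * n else 15 * (k - 1))"
          proof (elim disjE exE conjE)
            fix l assume "l < n" "l \<noteq> i0" "w = 15 * l" "R (15 * l) \<le> R (15 * k)" "l = Suc k"
            then show ?thesis using R_root[OF \<open>l < n\<close>] R_root[OF block(1)] k(1) by (auto split: if_splits)
          next
            fix l assume "l < n" "w = 15 * l" "k = Suc l"
            then show ?thesis by simp
          next
            assume "w = 15 * n" "k = 0"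
            then show ?thesis by simp
          next
            assume "i0 < n" "k = n - 1" "R (15 * n) \<le> R (15 * k)"
            then show ?thesis using R_root[OF block(1)] R_top k(1) n by (auto split: if_splits)
          qed
        qed
      next
        case False
        have j: "0 < j" "j < 15" using False P15[OF block(2)] by auto
        define C where "C = {a \<in> P (st k). adjacent gadget j a \<and> r (st k) a \<le> r (st k) j}"
        have W: "\<exists>a. a < 15 \<and> w = 15 * k + a \<and> a \<in> C"
          if "w \<in> ?W" for w
        proof -
          have w: "w \<in> A" "adjacent (chain n) (15 * k + j) w" "R w \<le> R (15 * k + j)" using that block by auto
          obtain a where a: "a < 15" "w = 15 * k + a" "joined j a"
            using inner_neighbour[OF block(1) j w(2)] by blast
          have "a \<in> P (st k)" using in_A[OF block(1) a(1)] w(1) a(2) by simp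
          moreover have "a \<noteq> 0"
          proof
            assume "a = 0"
            then have "st k = 15" using \<open>a \<in> P (st k)\<close> P(5)[OF st] by blast
            then show False using P(6)[of j] block(2) a(3) \<open>a = 0\<close> joined_sym by metis
          qed
          ultimately show ?thesis
            using a w(3) R_inner[OF block(1) j] R_inner[OF block(1) _ a(1)] by (auto simp: C_def adjacent_gadget)
        qed
        show ?thesis
          unfolding clique_def
        proof (intro ballI impI)
          fix w w' assume "w \<in> ?W" "w' \<in> ?W" and ne: "w \<noteq> w'"
          from W[OF this(1)] W[OF this(2)] obtain a b where ab: "a < 15" "w = 15 * k + a" "b < 15" "w' = 15 * k + b"
              "a \<in> C"
              "b \<in> C"
            by blast
          have "clique C (edges gadget)"
            using P(3)[OF st, of k] block(2) unfolding ranked_def C_def by (rule bspec)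
          moreover have "a \<noteq> b" using ne ab(2,4) by blast
          ultimately have "adjacent gadget a b" using ab(5,6) by (simp add: clique_def)
          then show "adjacent (chain n) w w'"
            unfolding ab(2,4) adjacent_block[OF block(1) ab(1,3)] adjacent_gadget .
        qed
      qed
    qed
  qed
  moreover have "triangle_free gadget ({..<15} - block_part A k - (if k = i0 then {s} else {}))" if "k < n" for k
    by (rule triangle_free_subset[OF P(4)[OF st, of k]])
       (use that i0 in \<open>auto simp: part[OF that] st_def\<close>)
  moreover have "15 * i0 + s \<notin> A" if "i0 < n"
    using in_A[OF that, of s] P(2)[OF s(1)] s that by (simp add: st_def)
  ultimately show thesis
    using that[of A] A root_A top_A[of "15 * n"] top_A[of "15 * n + 1"] top_A[of "15 * n + 2"] by simp
qed

text \<open>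
  If \<open>u\<close> belongs to a gadget, \<open>v\<close> is in the perfect part, and every triangle of roots and apexes contains \<open>v\<close>. If \<open>u\<close> is
  an apex, all roots are in the perfect part and only two vertices are left on the other side.
\<close>

lemma chain_critical:
  assumes u: "u \<in> verts (chain n)"
  shows "\<exists>A B. A \<union> B = verts (chain n) - {u} \<and> A \<inter> B = {} \<and>
    perfect (induced (chain n) A) \<and> triangle_free (chain n) B"
proof -
  obtain i0 s where i0: "i0 \<le> n" "s \<le> 15" "s = 15 \<longleftrightarrow> i0 = n"
    and u': "(i0 < n \<and> u = 15 * i0 + s) \<or> (i0 = n \<and> u \<in> {15 * n, 15 * n + 1, 15 * n + 2})"
  proof (cases "u < 15 * n")
    case True
    then have "u div 15 < n" using less_mult_imp_div_less[of u n 15] by (simp add: mult.commute)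
    then show thesis using that[of "u div 15" "u mod 15"] by auto
  next
    case False
    then have "u = 15 * n \<or> u = 15 * n + 1 \<or> u = 15 * n + 2" using u by simp linarith
    then show thesis using that[of n 15] by simp
  qed
  obtain A where A: "A \<subseteq> verts (chain n)" "perfect (induced (chain n) A)"
    "\<And>k. k < n \<Longrightarrow> triangle_free gadget ({..<15} - block_part A k - (if k = i0 then {s} else {}))"
    "\<And>k. k < n \<Longrightarrow> 15 * k \<in> A \<longleftrightarrow> k \<noteq> i0" "15 * n \<in> A \<longleftrightarrow> i0 < n"
    "15 * n + 1 \<notin> A" "15 * n + 2 \<notin> A" "i0 < n \<Longrightarrow> 15 * i0 + s \<notin> A"
    using chain_partition[OF i0] by blast
  define B where "B = verts (chain n) - {u} - A"
  have uA: "u \<notin> A" using u' A(5-8) by auto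
  have "triangle_free (chain n) B"
  proof (rule triangle_free_chainI)
    fix k assume k: "k < n"
    show "triangle_free gadget (block_part B k)"
      by (rule triangle_free_subset[OF A(3)[OF k]]) (use u' k in \<open>auto simp: block_part_def B_def\<close>)
  next
    show "triangle_free (chain n) (B \<inter> spine_verts n)"
    proof (rule triangle_freeI)
      fix x y z
      assume X: "x \<in> B \<inter> spine_verts n" "y \<in> B \<inter> spine_verts n" "z \<in> B \<inter> spine_verts n"
        and adj: "adjacent (chain n) x y" "adjacent (chain n) y z" "adjacent (chain n) x z"
      have "15 * n \<in> {x, y, z}" using spine_triangle X adj by blast
      then have v: "15 * n \<in> B" using X by auto
      then have "i0 = n" using A(5) i0(1) by (auto simp: B_def)
      then have "u \<in> {15 * n + 1, 15 * n + 2}" using u' v by (auto simp: B_def)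
      moreover have "w \<in> {15 * n, 15 * n + 1, 15 * n + 2}" if "w \<in> B \<inter> spine_verts n" for w
        using that A(4) \<open>i0 = n\<close> by (auto simp: B_def spine_verts_def)
      then have "{x, y, z} \<subseteq> {15 * n, 15 * n + 1, 15 * n + 2} - {u}" using X by (auto simp: B_def)
      ultimately have "x = y \<or> y = z \<or> x = z" by auto
      then show False using adjacent_neq[OF simple_chain] adj by blast
    qed
  qed
  moreover have "A \<union> B = verts (chain n) - {u}" "A \<inter> B = {}" using A(1) uA by (auto simp: B_def)
  ultimately show ?thesis using A(2) by blast
qed

section \<open>Triangle-free subsets of a chain\<close>

text \<open>
  Roots are coloured alternately, except that the last root gets \<open>\<delta>\<close>; the apexes get \<open>\<alpha>\<close>, \<open>\<beta>\<close> and \<open>\<gamma>\<close>. If both \<open>b\<close> and \<open>c\<close>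
  occur, \<open>v\<close> does not, and \<open>\<delta>\<close> is changed to make room for \<open>c\<close>. Otherwise a colour is left for \<open>v\<close> because \<open>X\<close> misses
  the end of the path that would form a triangle with \<open>v\<close> and the remaining apex.
\<close>

lemma spine_colouring:
  assumes X: "X \<subseteq> spine_verts n" and tf: "triangle_free (chain n) X"
  obtains f where "colouring_on (chain n) X 3 f"
proof -
  let ?v = "15 * n" and ?b = "15 * n + 1" and ?c = "15 * n + 2" and ?z = "15 * (n - 1)"
  define f where "f \<alpha> \<beta> \<gamma> \<delta> x = (if x = ?v then \<alpha> else if x = ?b then \<beta> else if x = ?c then \<gamma>
    else if x = ?z then \<delta> else (x div 15) mod 2)" for \<alpha> \<beta> \<gamma> \<delta> x :: nat
  have colouring: "colouring_on (chain n) X 3 (f \<alpha> \<beta> \<gamma> \<delta>)"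
    if lt: "\<alpha> < 3" "\<beta> < 3" "\<gamma> < 3" "\<delta> < 3" and "\<delta> \<noteq> 0"
      and v: "?v \<in> X \<Longrightarrow> 0 \<in> X \<Longrightarrow> \<alpha> \<noteq> 0" "?v \<in> X \<Longrightarrow> ?z \<in> X \<Longrightarrow> \<alpha> \<noteq> \<delta>"
        "?v \<in> X \<Longrightarrow> ?b \<in> X \<Longrightarrow> \<alpha> \<noteq> \<beta>" "?v \<in> X \<Longrightarrow> ?c \<in> X \<Longrightarrow> \<alpha> \<noteq> \<gamma>"
      and b: "?b \<in> X \<Longrightarrow> \<beta> = 2" and bc: "?b \<in> X \<Longrightarrow> ?c \<in> X \<Longrightarrow> \<beta> \<noteq> \<gamma>"
      and c: "?c \<in> X \<Longrightarrow> \<gamma> \<noteq> 0 \<and> \<gamma> \<noteq> \<delta>" for \<alpha> \<beta> \<gamma> \<delta>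
  proof -
    let ?f = "f \<alpha> \<beta> \<gamma> \<delta>"
    have f_root: "?f (15 * i) = (if i = n - 1 then \<delta> else i mod 2)" if "i < n" for i
      using that by (auto simp: f_def)
    have f_apex: "?f ?v = \<alpha>" "?f ?b = \<beta>" "?f ?c = \<gamma>" by (simp_all add: f_def)
    have roots: "?f 0 = 0" "?f (15 * 3) = 1" "?f (15 * (n - 4)) = 0" "?f ?z = \<delta>"
      using f_root[of 0] f_root[of 3] f_root[of "n - 4"] f_root[of "n - 1"] n even by auto
    have spine: "?f x \<noteq> ?f y" if xy: "x \<in> X" "y \<in> X" "(x, y) \<in> spine n" for x y
    proof -
      from xy(3) consider i where "Suc i < n" "x = 15 * i" "y = 15 * Suc i"
        | "x = 0" "y = ?v" | "x = ?z" "y = ?v" | "x = ?v" "y = ?b" | "x = ?v" "y = ?c"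
        | "x = ?b" "y = ?c" | "x = 0" "y = ?b" | "x = 15 * 3" "y = ?b" | "x = 15 * (n - 4)" "y = ?c"
        | "x = ?z" "y = ?c"
        unfolding spine_def by blast
      then show ?thesis
      proof cases
        case (1 i)
        have "i mod 2 = 0" if "Suc i = n - 1" using that even n by (simp, presburger)
        moreover have "i mod 2 \<noteq> Suc i mod 2" by presburger
        moreover have "i \<noteq> n - 1" using 1(1) by simp
        ultimately show ?thesis
          using 1 f_root[of i] f_root[of "Suc i"] \<open>\<delta> \<noteq> 0\<close> by simp
      qed (use xy roots f_apex v b bc c in auto)
    qed
    have "?f x \<noteq> ?f y" if "x \<in> X" "y \<in> X" "adjacent (chain n) x y" for x y
      using spine[of x y] spine[of y x] adjacent_spine that X by (metis subsetD)
    moreover have "?f x < 3" for x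
    proof -
      have "x div 15 mod 2 < 3" by (rule less_trans[of _ 2]) simp_all
      then show ?thesis using lt by (simp add: f_def)
    qed
    ultimately show ?thesis unfolding colouring_on_def by blast
  qed
  have no_triangle: "\<not> (?v \<in> X \<and> ?b \<in> X \<and> ?c \<in> X)" "\<not> (?v \<in> X \<and> ?b \<in> X \<and> 0 \<in> X)"
    "\<not> (?v \<in> X \<and> ?c \<in> X \<and> ?z \<in> X)"
    using triangle_freeD[OF tf, of ?v ?b ?c] triangle_freeD[OF tf, of ?v ?b 0] triangle_freeD[OF tf, of ?v ?c ?z]
    by (auto simp: adjacent_chain spine_def)
  show thesis
  proof (cases "?b \<in> X")
    case False
    show thesis
      by (rule that[OF colouring[of "if ?c \<in> X then 1 else 2" 0 2 1]]) (use False no_triangle in auto)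
  next
    case b: True
    show thesis
    proof (cases "?c \<in> X")
      case False
      show thesis
        by (rule that[OF colouring[of 0 2 0 1]]) (use b False no_triangle in auto)
    next
      case True
      show thesis
        by (rule that[OF colouring[of 0 2 1 2]]) (use b True no_triangle in auto)
    qed
  qed
qed

text \<open>
  Each gadget meets the roots and apexes in its root alone. So the two kinds of colourings fit together once two
  colours are swapped in each gadget whose root is in \<open>X\<close>.
\<close>

lemma chain_three_colourable:
  assumes X: "X \<subseteq> verts (chain n)" and tf: "triangle_free (chain n) X"
  shows "\<exists>c. colouring_on (chain n) X 3 c"
proof -
  obtain f where f: "colouring_on (chain n) (X \<inter> spine_verts n) 3 f"
    using spine_colouring[of "X \<inter> spine_verts n"] triangle_free_subset[OF tf] by blast
  have "\<forall>i. \<exists>c. i < n \<longrightarrow> colouring_on gadget (block_part X i) 3 c"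
  proof
    fix i
    have "block_part X i \<subseteq> {..<15}" by (auto simp: block_part_def)
    then show "\<exists>c. i < n \<longrightarrow> colouring_on gadget (block_part X i) 3 c"
      using gadget_hereditarily_3_colourable triangle_free_block_part[OF tf]
      unfolding hereditarily_3_colourable_def by blast
  qed
  from choice[OF this] obtain c where c: "\<And>i. i < n \<Longrightarrow> colouring_on gadget (block_part X i) 3 (c i)"
    by blast
  \<comment> \<open>The transposition of the two colours that the root of gadget \<open>i\<close> has in the two colourings.\<close>
  define \<pi> where "\<pi> i d = (if 15 * i \<notin> X then d else if d = c i 0 then f (15 * i)
    else if d = f (15 * i) then c i 0 else d)" for i d
  define h where "h x = (if x \<in> spine_verts n then f x else \<pi> (x div 15) (c (x div 15) (x mod 15)))" for x
  have \<pi>_inj: "\<pi> i d \<noteq> \<pi> i e" if "d \<noteq> e" for i d e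
    using that by (auto simp: \<pi>_def)
  have root: "c i 0 < 3" "f (15 * i) < 3" if "i < n" "15 * i \<in> X" for i
    using c[OF that(1)] f root_in_spine[OF that(1)] that(2)
    unfolding colouring_on_def block_part_def by auto
  have h_inner: "h (15 * i + j) = \<pi> i (c i j)" if "i < n" "0 < j" "j < 15" for i j
    using that inner_not_spine[OF that] by (simp add: h_def)
  have inner_proper: "h (15 * i + j) \<noteq> h y"
    if ij: "i < n" "0 < j" "j < 15" and mem: "15 * i + j \<in> X" "y \<in> X"
      and adj: "adjacent (chain n) (15 * i + j) y" for i j y
  proof -
    obtain k where k: "k < 15" "y = 15 * i + k" "joined j k"
      using inner_neighbour[OF ij adj] by blast
    then have jk: "j \<in> block_part X i" "k \<in> block_part X i" using mem ij by (auto simp: block_part_def)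
    have "c i j \<noteq> c i k"
      using c[OF ij(1)] jk k(3) unfolding colouring_on_def adjacent_gadget by blast
    then have ne: "\<pi> i (c i j) \<noteq> \<pi> i (c i k)" by (rule \<pi>_inj)
    show ?thesis
    proof (cases "k = 0")
      case False
      then show ?thesis using ne h_inner[OF ij] h_inner[OF ij(1) _ k(1)] k(2) by simp
    next
      case True
      then have "h y = f (15 * i)" "\<pi> i (c i k) = f (15 * i)"
        using k(2) root_in_spine[OF ij(1)] mem(2) by (simp_all add: h_def \<pi>_def)
      then show ?thesis using ne h_inner[OF ij] by simp
    qed
  qed
  have "h x \<noteq> h y" if mem: "x \<in> X" "y \<in> X" and adj: "adjacent (chain n) x y" for x y
  proof -
    have lt: "x < 15 * n + 3" "y < 15 * n + 3" using mem X by auto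
    show ?thesis
      using lt(1)
    proof (cases rule: vertex_cases)
      case (inner i j)
      then show ?thesis using inner_proper[OF inner(1-3) _ mem(2)] mem(1) adj by simp
    next
      case x: spine
      show ?thesis
        using lt(2)
      proof (cases rule: vertex_cases)
        case (inner i j)
        then show ?thesis
          using inner_proper[OF inner(1-3) _ mem(1)] mem(2) adjacent_sym[OF adj] by simp
      next
        case spine
        then show ?thesis using f x mem adj unfolding colouring_on_def h_def by auto
      qed
    qed
  qed
  moreover have "h x < 3" if x: "x \<in> X" for x
  proof -
    have "x < 15 * n + 3" using x X by auto
    then show ?thesis
    proof (cases rule: vertex_cases)
      case spine
      then show ?thesis using f x unfolding colouring_on_def h_def by auto
    next
      case (inner i j)
      then have "j \<in> block_part X i" using x by (simp add: block_part_def)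
      then have "c i j < 3" using c[OF inner(1)] unfolding colouring_on_def by blast
      then show ?thesis using h_inner[OF inner(1-3)] root[OF inner(1)] inner(4) by (simp add: \<pi>_def)
    qed
  qed
  ultimately show ?thesis unfolding colouring_on_def by blast
qed

section \<open>Clique number, size and the bisimplicial vertex\<close>

text \<open>
  A clique with a vertex other than roots and apexes lies in one gadget, which contains no clique of size 4. A clique of
  roots and apexes has at most two vertices besides \<open>v\<close>.
\<close>

lemma clique_number_chain: "clique_number (chain n) = 3"
proof (rule antisym)
  have fin: "finite (verts (chain n))" by simp
  have whole: "induced (chain n) (verts (chain n)) = chain n"
    using simple_chain by (cases "chain n") (auto simp: induced_def simple_graph_def)
  have "3 \<le> clique_number (induced (chain n) (verts (chain n)))"
    by (rule clique_number_triangle[OF simple_chain fin _ _ _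
          adjacent_apexes(1,3,2)]) simp_all
  then show "3 \<le> clique_number (chain n)" unfolding whole .
  show "clique_number (chain n) \<le> 3"
  proof -
    obtain K where K: "K \<subseteq> verts (chain n)" "clique K (edges (chain n))" "card K = clique_number (chain n)"
      using maximum_clique[OF fin, of "chain n"] whole by metis
    have finK: "finite K" using K(1) finite_subset[OF _ fin] by blast
    have "card K \<le> 3"
    proof (cases "K \<subseteq> spine_verts n")
      case True
      have "triangle_free (chain n) (K - {15 * n})"
        using spine_triangle True by (intro triangle_freeI) blast
      then have "clique_number (induced (chain n) (K - {15 * n})) \<le> 2"
        using clique_number_triangle_free finK by blast
      moreover have "card (K - {15 * n}) \<le> clique_number (induced (chain n) (K - {15 * n}))"
        using card_clique_le[of "K - {15 * n}" "K - {15 * n}"] finK smaller_clique[OF K(2)] by blast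
      ultimately show ?thesis using card_Diff1_le[of K "15 * n"] card_Suc_Diff1[OF finK, of "15 * n"]
        by (cases "15 * n \<in> K") auto
    next
      case False
      then obtain x where x: "x \<in> K" "x \<notin> spine_verts n" by blast
      then have "x < 15 * n + 3" using K(1) by auto
      then obtain i j where ij: "i < n" "0 < j" "j < 15" "x = 15 * i + j"
        using x(2) by (cases rule: vertex_cases) blast+
      have block: "\<exists>a. a < 15 \<and> w = 15 * i + a" if "w \<in> K" for w
      proof (cases "w = x")
        case False
        then have "adjacent (chain n) x w" using K(2) x(1) that by (auto simp: clique_def)
        then show ?thesis using inner_neighbour[OF ij(1-3)] unfolding ij(4) by blast
      qed (use ij in blast)
      show ?thesis
      proof (rule ccontr)
        assume "\<not> card K \<le> 3"
        then obtain T where T: "T \<subseteq> K" "card T = Suc (Suc (Suc (Suc 0)))"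
          using obtain_subset_with_card_n[of 4 K] by (auto simp: eval_nat_numeral)
        then obtain p q r s where pqrs: "T = {p, q, r, s}" "p \<noteq> q" "p \<noteq> r" "p \<noteq> s" "q \<noteq> r" "q \<noteq> s" "r \<noteq> s"
          by (auto simp: card_Suc_eq)
        obtain a b c d where abcd: "a < 15" "b < 15" "c < 15" "d < 15"
            "p = 15 * i + a" "q = 15 * i + b" "r = 15 * i + c" "s = 15 * i + d"
          using block[of p] block[of q] block[of r] block[of s] T(1) pqrs(1) by auto
        have adj: "joined g h" if "g < 15" "h < 15" "15 * i + g \<in> T" "15 * i + h \<in> T" "15 * i + g \<noteq> 15 * i + h" for g h
          using K(2) T(1) that adjacent_block[OF ij(1) that(1,2)] unfolding clique_def by blast
        show False
          by (rule gadget_no_K4[of a b c d]; rule adj) (use abcd pqrs in auto)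
      qed
    qed
    then show ?thesis using K(3) by simp
  qed
qed

lemma card_gadget_edges: "card (set gadget_edges) = 51"
proof -
  have "distinct gadget_edges" "length gadget_edges = 51" by (simp_all add: gadget_edges_def)
  then show ?thesis using distinct_card by metis
qed

lemma card_blocks: "card (blocks n) = 51 * n"
proof -
  let ?f = "\<lambda>(i, j, k). (15 * i + j :: nat, 15 * i + k :: nat)"
  have "blocks n = ?f ` ({..<n} \<times> set gadget_edges)" by (force simp: blocks_def)
  moreover have "inj_on ?f ({..<n} \<times> set gadget_edges)"
  proof (rule inj_onI)
    fix p q assume p: "p \<in> {..<n} \<times> set gadget_edges" and q: "q \<in> {..<n} \<times> set gadget_edges"
      and eq: "?f p = ?f q"
    obtain i j k where "p = (i, j, k)" by (cases p)
    moreover obtain i' j' k' where "q = (i', j', k')" by (cases q)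
    moreover have "j < 15" "k < 15" "j' < 15" "k' < 15"
      using gadget_edges_less[of j k] gadget_edges_less[of j' k'] p q calculation by auto
    ultimately show "p = q" using eq block_coordinates[of j j' i i'] block_coordinates[of k k' i i'] by simp
  qed
  ultimately show ?thesis by (simp add: card_image card_cartesian_product card_gadget_edges)
qed

lemma card_spine: "card (spine n) = n + 8"
proof -
  define P where "P = (\<lambda>i. (15 * i, 15 * Suc i)) ` {..<n - 1}"
  define Q where "Q = {(0, 15 * n), (15 * (n - 1), 15 * n), (15 * n, 15 * n + 1), (15 * n, 15 * n + 2),
      (15 * n + 1, 15 * n + 2), (0, 15 * n + 1), (15 * 3, 15 * n + 1),
      (15 * (n - 4), 15 * n + 2), (15 * (n - 1), 15 * n + 2)}"
  have "{(15 * i, 15 * Suc i) |i. Suc i < n} = P" by (auto simp: P_def)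
  then have "spine n = P \<union> Q" unfolding spine_def Q_def by simp
  moreover have "P \<inter> Q = {}" using n by (auto simp: P_def Q_def)
  moreover have "card P = n - 1"
    unfolding P_def by (subst card_image) (auto simp: inj_on_def)
  moreover have "card Q = 9"
  proof -
    obtain m where "n = m + 6" using n that[of "n - 6"] by simp
    then show ?thesis by (simp add: Q_def)
  qed
  moreover have "finite P" "finite Q" by (simp_all add: P_def Q_def)
  ultimately show ?thesis using n by (simp add: card_Un_disjoint)
qed

lemma card_edges_chain: "card (edges (chain n)) = 52 * n + 8"
proof -
  let ?e = "\<lambda>(x, y). {x, y :: nat}"
  have less: "x < y" if "(x, y) \<in> blocks n \<union> spine n" for x y
    using that blocks_less spine_less by blast
  have "edges (chain n) = ?e ` (blocks n \<union> spine n)" by (force simp: chain_def)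
  moreover have "inj_on ?e (blocks n \<union> spine n)"
  proof (rule inj_onI)
    fix p q assume p: "p \<in> blocks n \<union> spine n" and q: "q \<in> blocks n \<union> spine n" and eq: "?e p = ?e q"
    obtain x y where xy: "p = (x, y)" by (cases p)
    obtain x' y' where xy': "q = (x', y')" by (cases q)
    have "x < y" "x' < y'" using less p q xy xy' by blast+
    then show "p = q" using eq xy xy' by (auto simp: doubleton_eq_iff)
  qed
  moreover have "blocks n \<inter> spine n = {}"
  proof -
    have False if xy: "(x, y) \<in> blocks n" "(x, y) \<in> spine n" for x y
    proof -
      obtain i j k where *: "i < n" "y = 15 * i + k" "(j, k) \<in> set gadget_edges"
        using xy(1) unfolding blocks_def by blast
      then have "0 < k" "k < 15" using gadget_edges_less[OF *(3)] by auto
      then show False using inner_not_spine[OF *(1)] spine_subset[OF xy(2)] *(2) by blast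
    qed
    then show ?thesis by auto
  qed
  moreover have "finite (blocks n)" "finite (spine n)"
    using card_blocks card_spine n by (auto intro: card_ge_0_finite)
  ultimately show ?thesis
    by (simp add: card_image card_Un_disjoint card_blocks card_spine)
qed

lemma nbhd_apex: "nbhd (chain n) (15 * n) = {0, 15 * (n - 1), 15 * n + 1, 15 * n + 2}"
proof
  show "nbhd (chain n) (15 * n) \<subseteq> {0, 15 * (n - 1), 15 * n + 1, 15 * n + 2}"
  proof
    fix w assume "w \<in> nbhd (chain n) (15 * n)"
    then have w: "w < 15 * n + 3" "adjacent (chain n) (15 * n) w" by (auto simp: nbhd_def)
    have "w \<noteq> 15 * n" using adjacent_neq[OF simple_chain w(2)] by simp
    from w(1) show "w \<in> {0, 15 * (n - 1), 15 * n + 1, 15 * n + 2}"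
    proof (cases rule: vertex_cases)
      case spine
      then consider i where "i < n" "w = 15 * i" | "w = 15 * n + 1" | "w = 15 * n + 2"
        using \<open>w \<noteq> 15 * n\<close> unfolding spine_verts_def by blast
      then show ?thesis
      proof cases
        case (1 i)
        then show ?thesis using adjacent_apex_root(1)[OF 1(1)] w(2) by auto
      qed simp_all
    next
      case (inner i j)
      then have "adjacent (chain n) (15 * i + j) (15 * n)" using adjacent_sym[OF w(2)] by simp
      then obtain k where "k < 15" "15 * n = 15 * i + k"
        using inner_neighbour[OF inner(1-3)] by blast
      then show ?thesis using inner(1) by simp
    qed
  qed
  show "{0, 15 * (n - 1), 15 * n + 1, 15 * n + 2} \<subseteq> nbhd (chain n) (15 * n)"
    using adjacent_apexes adjacent_apex_root(1)[of 0] adjacent_apex_root(1)[of "n - 1"] n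
    by (auto simp: nbhd_def)
qed

lemma degree_apex: "degree (chain n) (15 * n) = 4"
proof -
  obtain m where "n = m + 6" using n that[of "n - 6"] by simp
  then show ?thesis unfolding degree_def nbhd_apex by simp
qed

lemma bisimplicial_apex: "bisimplicial (chain n) (15 * n)"
proof -
  have "clique {0, 15 * n + 1} (edges (chain n))"
    using adjacent_apex_root(2)[of 0] n by (auto simp: clique_def insert_commute)
  moreover have "clique {15 * (n - 1), 15 * n + 2} (edges (chain n))"
    using adjacent_apex_root(3)[of "n - 1"] n by (auto simp: clique_def insert_commute)
  moreover have "nbhd (chain n) (15 * n) = {0, 15 * n + 1} \<union> {15 * (n - 1), 15 * n + 2}"
    unfolding nbhd_apex by auto
  ultimately show ?thesis unfolding bisimplicial_def by blast
qed

lemma mnpd_chain: "mnpd (chain n)"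
  using simple_chain clique_number_chain chain_indivisible
    chain_critical chain_three_colourable
  by (rule mnpdI)

end

theorem theorem1p2:
  shows "\<exists>(G :: nat \<Rightarrow> nat ugraph) (v :: nat \<Rightarrow> nat).
    (\<forall>s\<ge>1. \<forall>t\<ge>1. s \<noteq> t \<longrightarrow> \<not> graph_iso (G s) (G t)) \<and>
    (\<forall>t\<ge>1. simple_graph (G t) \<and> v t \<in> verts (G t) \<and>
      mnpd (G t) \<and> clique_number (G t) = 3 \<and>
      bisimplicial (G t) (v t) \<and> degree (G t) (v t) = 4 \<and>
      card (verts (G t)) = 93 + 30 * (t - 1) \<and>
      card (edges (G t)) = 320 + 104 * (t - 1))"
proof (intro exI[of _ "\<lambda>t. chain (2 * t + 4)"] exI[of _ "\<lambda>t. 15 * (2 * t + 4)"] conjI allI impI)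
  fix s t :: nat assume "s \<noteq> t"
  show "\<not> graph_iso (chain (2 * s + 4)) (chain (2 * t + 4))"
  proof
    assume "graph_iso (chain (2 * s + 4)) (chain (2 * t + 4))"
    then have "card {..<15 * (2 * s + 4) + 3} = card {..<15 * (2 * t + 4) + 3}"
      unfolding graph_iso_def verts_chain using bij_betw_same_card by blast
    then show False using \<open>s \<noteq> t\<close> by simp
  qed
next
  fix t :: nat assume t: "1 \<le> t"
  then have n: "6 \<le> 2 * t + 4" "even (2 * t + 4)" by auto
  note facts = simple_chain[OF n] mnpd_chain[OF n] clique_number_chain[OF n] bisimplicial_apex[OF n]
    degree_apex[OF n] card_edges_chain[OF n]
  show "simple_graph (chain (2 * t + 4))" "mnpd (chain (2 * t + 4))"
    "clique_number (chain (2 * t + 4)) = 3" "bisimplicial (chain (2 * t + 4)) (15 * (2 * t + 4))"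
    "degree (chain (2 * t + 4)) (15 * (2 * t + 4)) = 4"
    by (rule facts)+
  show "15 * (2 * t + 4) \<in> verts (chain (2 * t + 4))" by simp
  show "card (verts (chain (2 * t + 4))) = 93 + 30 * (t - 1)" using t by simp
  show "card (edges (chain (2 * t + 4))) = 320 + 104 * (t - 1)" using t facts(6) by simp
qed

end
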